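(* Let $\alpha>0$. There exist constants $C_1, C_2$, not depending on $p$ (nor on $a$), such that for all real $p\ge 0$ and all real $a$ with $0<a<\alpha p$, $$\left|\frac{\zeta(-p,a)}{Q(-p)}-\sin\left(2\pi a-\tfrac12\pi p\right)\right|<C_1\,p^{-1/2}(2\pi e\alpha)^p+C_2\,2^{-p}.$$ In particular, on the interval $0<a<\frac{p}{2\pi e}$ one has $$\frac{\zeta(-p,a)}{Q(-p)}=\sin\left(2\pi a-\tfrac12\pi p\right)+o(1)\qquad\text{as } p\to\infty,$$ where the $o(1)$ term is uniform in $a$, i.e. $\sup_{0<a<p/(2\pi e)}\left|\frac{\zeta(-p,a)}{Q(-p)}-\sin(2\pi a-\frac12\pi p)\right|\to 0$ as $p\to\infty$.
   Context: For real $a>0$ (all positive $a$ are allowed, not only $0<a\le 1$), $\zeta(s,a)$ denotes the Hurwitz zeta-function: the analytic continuation in $s$ to $\mathbb{C}\setminus\{1\}$ of $\sum_{r=0}^{\infty}(a+r)^{-s}$, which converges for $\mathrm{Re}(s)>1$. The normalising factor is $Q(s)=\frac{2\Gamma(1-s)}{(2\pi)^{1-s}}$, so that $Q(-p)=\frac{2\Gamma(1+p)}{(2\pi)^{1+p}}$, where $\Gamma$ is the Euler gamma-function. *)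

theory Defs
  imports "HOL-Complex_Analysis.Complex_Analysis"
begin

definition hurwitz_continuation :: "real \<Rightarrow> (complex \<Rightarrow> complex) \<Rightarrow> bool" where
  "hurwitz_continuation a f \<longleftrightarrow>
     f holomorphic_on (- {1}) \<and>
     (\<forall>s. Re s > 1 \<longrightarrow> (\<lambda>r. complex_of_real (a + real r) powr (- s)) sums f s)"

text \<open>
  The Hurwitz zeta function, meaningful for \<open>a > 0\<close>. The condition \<open>f 1 = 0\<close> only fixes
  a dummy value at the pole, so that the continuation is unique as a total function.
\<close>

definition hurwitz_zeta :: "complex \<Rightarrow> real \<Rightarrow> complex" where
  "hurwitz_zeta s a = (THE f. hurwitz_continuation a f \<and> f 1 = 0) s"

definition hurwitz_Q :: "complex \<Rightarrow> complex" where
  "hurwitz_Q s = 2 * Gamma (1 - s) / (2 * complex_of_real pi) powr (1 - s)"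

lemma hurwitz_continuation_unique:
  assumes f: "hurwitz_continuation a f" and g: "hurwitz_continuation a g" and "s \<noteq> 1"
  shows "f s = g s"
proof (rule analytic_continuation_open[of "{s. Re s > 1}" "- {1}" f g])
  show "open {s. Re s > 1}"
    by (rule open_halfspace_Re_gt)
  have "2 \<in> {s. Re s > 1}"
    by simp
  then show "{s. Re s > 1} \<noteq> {}"
    by blast
  show "connected (- {1 :: complex})"
    by (intro connected_punctured_universe) simp
  show "f z = g z" if "z \<in> {s. Re s > 1}" for z
    using f g that unfolding hurwitz_continuation_def by (auto intro: sums_unique2)
qed (use assms in \<open>auto simp: hurwitz_continuation_def\<close>)

lemma hurwitz_zeta_eqI:
  assumes f: "hurwitz_continuation a f" and s: "s \<noteq> 1"
  shows "hurwitz_zeta s a = f s"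
proof -
  let ?g = "f(1 := 0)"
  have "?g holomorphic_on (- {1}) \<longleftrightarrow> f holomorphic_on (- {1})"
    by (rule holomorphic_cong) auto
  with f have g: "hurwitz_continuation a ?g"
    by (auto simp: hurwitz_continuation_def)
  have "(THE f. hurwitz_continuation a f \<and> f 1 = 0) = ?g"
  proof (rule the_equality)
    fix h assume h: "hurwitz_continuation a h \<and> h 1 = 0"
    show "h = ?g"
    proof
      fix z show "h z = ?g z"
        using h hurwitz_continuation_unique[OF _ g, of h z] by (cases "z = 1") auto
    qed
  qed (use g in auto)
  with s show ?thesis
    by (simp add: hurwitz_zeta_def)
qed

end

theory Submission
  imports Defs "HOL-Real_Asymp.Real_Asymp"
begin

text \<open>
  For \<open>0 < a \<le> 1\<close> the theorem is read off from Hurwitz's formula (\<open>hurwitz_formula\<close>): for \<open>p > 0\<close>,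
  the quotient \<open>\<zeta>(-p,a) / Q(-p)\<close> is the sum over \<open>n \<ge> 1\<close> of
  \<open>sin (2\<pi>na - \<pi>p/2) / n powr (1 + p)\<close>. Its first term is the sine of the theorem, and the
  other terms add up to \<open>O(2 powr (-p))\<close> as long as \<open>p\<close> stays away from \<open>0\<close>. As \<open>p\<close>
  tends to \<open>0\<close>, absolute values only bound the tail by a multiple of \<open>1/p\<close>; there \<open>\<zeta>(-p,a)\<close> is
  bounded directly by Euler-Maclaurin summation.

  A general \<open>a\<close> is \<open>b + m\<close> with \<open>0 < b \<le> 1\<close> and a natural number \<open>m\<close>. The sine has the same value at
  \<open>a\<close> and \<open>b\<close>, and \<open>\<zeta>(-p,a)\<close> differs from \<open>\<zeta>(-p,b)\<close> by the sum of \<open>(b+j) powr p\<close> over \<open>j < m\<close>.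
  As \<open>a < \<alpha>p\<close>, these powers, taken from the largest downwards, decay at least like a geometric
  series of ratio \<open>exp (-1/\<alpha>)\<close> (\<open>sum_shifted_powers_le\<close>), so they add up to
  \<open>O((\<alpha>p) powr p)\<close>. Division by \<open>Q(-p)\<close>, together with a lower bound for \<open>\<Gamma>(1+p)\<close> of Stirling's
  order of magnitude (\<open>Gamma_ge_stirling\<close>), turns this into the first error term. The uniform
  limit is the case \<open>\<alpha> = 1/(2\<pi>e)\<close>, in which \<open>(2\<pi>e\<alpha>) powr p = 1\<close>.

  The analytic continuation and Hurwitz's formula are obtained together. Comparing the Dirichlet
  series with an integral by the trapezoid rule continues it to \<open>Re s > -1\<close> (\<open>em_zeta\<close>), and the
  right-hand side of Hurwitz's formula is holomorphic for \<open>Re s < 0\<close>. Once the two functions agree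
  on the common strip, they glue to the continuation (\<open>hurwitz_continuation_unit_interval\<close>), and
  by the identity theorem it suffices that they agree at \<open>s = -p\<close> with \<open>0 < p < 1\<close>.

  For such \<open>p\<close>, consider the damped sum of \<open>(a+r) powr p * exp (-\<epsilon>(a+r))\<close> over \<open>r \<ge> 0\<close>.
  As a function of \<open>a\<close> on \<open>[0,1]\<close> it is continuous with equal values at the end points, and unfolding
  the sum shows that its \<open>n\<close>-th Fourier coefficient is the Laplace transform of \<open>x powr p\<close> at
  \<open>\<epsilon> + 2\<pi>in\<close>, which is \<open>\<Gamma>(1+p) (\<epsilon>+2\<pi>in) powr (-1-p)\<close>. Fourier inversion gives
  \<open>lipschitz_formula\<close>. Its term for \<open>n = 0\<close> is the integral of \<open>x powr p * exp (-\<epsilon>x)\<close> over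
  \<open>x \<ge> 0\<close>, which is what the trapezoid rule subtracts from the damped sum; so both sides
  converge as \<open>\<epsilon>\<close> tends to \<open>0\<close>, by Tannery's theorem, and the limits are the two functions to be
  compared (\<open>em_zeta_neg_eq_fourier_series\<close>).
\<close>

section \<open>Trapezoid errors and continuation to Re s > -1\<close>

text \<open>
  The function \<open>F\<close> stands for an antiderivative of \<open>f\<close>, so that \<open>F (x + 1) - F x\<close> is the integral of
  \<open>f\<close> over \<open>[x, x + 1]\<close>. Having it as a parameter leaves the choice between a closed form, which
  shows holomorphic dependence on an exponent, and an integral.
\<close>

definition trapezoid_error :: "(real \<Rightarrow> 'a::real_normed_vector) \<Rightarrow> (real \<Rightarrow> 'a) \<Rightarrow> real \<Rightarrow> 'a" where
  "trapezoid_error F f x = (1 / 2) *\<^sub>R (f x + f (x + 1)) - (F (x + 1) - F x)"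

lemma sum_trapezoid_error:
  "(\<Sum>r<N. trapezoid_error F f (x + real r)) =
     (\<Sum>r<N. f (x + real r)) + (1 / 2) *\<^sub>R (f (x + real N) - f x) - (F (x + real N) - F x)"
proof (induction N)
  case (Suc N)
  have half: "(1 / 2) *\<^sub>R y + (1 / 2) *\<^sub>R y = y" for y :: 'a
    by (simp flip: scaleR_add_left)
  have eq: "x + (1 + real N) = x + real N + 1"
    by simp
  show ?case
    using half[of "f (x + real N)"]
    unfolding sum.lessThan_Suc Suc unfolding of_nat_Suc eq trapezoid_error_def
    by (simp add: scaleR_add_right scaleR_diff_right algebra_simps)
qed simp

lemma norm_diff_le_vector_derivative:
  fixes f :: "real \<Rightarrow> 'a::real_normed_vector"
  assumes der: "\<And>t. t \<in> {a..b} \<Longrightarrow> (f has_vector_derivative f' t) (at t within {a..b})"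
    and bound: "\<And>t. t \<in> {a..b} \<Longrightarrow> norm (f' t) \<le> B"
    and xy: "x \<in> {a..b}" "y \<in> {a..b}"
  shows "norm (f x - f y) \<le> B * \<bar>x - y\<bar>"
  unfolding real_norm_def[symmetric]
proof (rule differentiable_bound[of "{a..b}" f "\<lambda>t h. h *\<^sub>R f' t"])
  fix t assume t: "t \<in> {a..b}"
  show "onorm (\<lambda>h. h *\<^sub>R f' t) \<le> B"
    using bound[OF t] by (intro onorm_le) (simp add: mult.commute[of B] mult_left_mono)
qed (use der xy in \<open>auto simp: has_vector_derivative_def\<close>)

text \<open>
  The error of the trapezoid rule on \<open>[x, t]\<close>, as a function of \<open>t\<close>, vanishes at \<open>x\<close> together with its
  first derivative, and its second derivative is \<open>((t - x) / 2) *\<^sub>R f'' t\<close>. Two applications of the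
  mean value inequality bound it; the constant is not optimal, but works for vector-valued \<open>f\<close>.
\<close>

lemma norm_trapezoid_error_le:
  fixes F :: "real \<Rightarrow> 'a::real_normed_vector"
  assumes F: "\<And>t. t \<in> {x..x+1} \<Longrightarrow> (F has_vector_derivative f t) (at t within {x..x+1})"
    and f: "\<And>t. t \<in> {x..x+1} \<Longrightarrow> (f has_vector_derivative f' t) (at t within {x..x+1})"
    and f': "\<And>t. t \<in> {x..x+1} \<Longrightarrow> (f' has_vector_derivative f'' t) (at t within {x..x+1})"
    and bound: "\<And>t. t \<in> {x..x+1} \<Longrightarrow> norm (f'' t) \<le> B"
  shows "norm (trapezoid_error F f x) \<le> B"
proof -
  define \<phi> where "\<phi> t = ((t - x) / 2) *\<^sub>R (f x + f t) - (F t - F x)" for t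
  define \<phi>' where "\<phi>' t = (1 / 2) *\<^sub>R (f x - f t) + ((t - x) / 2) *\<^sub>R f' t" for t
  define \<phi>'' where "\<phi>'' t = ((t - x) / 2) *\<^sub>R f'' t" for t
  have B: "B \<ge> 0"
    using bound[of x] norm_ge_zero[of "f'' x"] by (simp add: order_trans[OF norm_ge_zero])
  have half: "(1 / 2) *\<^sub>R y + (1 / 2) *\<^sub>R y = y" for y :: 'a
    by (simp flip: scaleR_add_left)
  have d1: "(\<phi> has_vector_derivative \<phi>' t) (at t within {x..x+1})" if "t \<in> {x..x+1}" for t
    unfolding \<phi>_def \<phi>'_def
    by (rule derivative_eq_intros F[OF that] f[OF that] refl | simp)+
      (use half[of "f t"] in \<open>simp add: algebra_simps\<close>)
  have d2: "(\<phi>' has_vector_derivative \<phi>'' t) (at t within {x..x+1})" if "t \<in> {x..x+1}" for t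
    unfolding \<phi>'_def \<phi>''_def
    by (rule derivative_eq_intros f[OF that] f'[OF that] refl | simp)+
  have b2: "norm (\<phi>'' t) \<le> B" if t: "t \<in> {x..x+1}" for t
  proof -
    have "norm (\<phi>'' t) = (t - x) / 2 * norm (f'' t)"
      using t by (simp add: \<phi>''_def)
    also have "\<dots> \<le> 1 * B"
      using t bound[OF t] by (intro mult_mono) auto
    finally show ?thesis by simp
  qed
  have b1: "norm (\<phi>' t) \<le> B" if t: "t \<in> {x..x+1}" for t
  proof -
    have "norm (\<phi>' t - \<phi>' x) \<le> B * \<bar>t - x\<bar>"
      by (rule norm_diff_le_vector_derivative[OF d2 b2]) (use t in auto)
    also have "\<dots> \<le> B * 1"
      using t B by (intro mult_left_mono) auto
    finally show ?thesis
      by (simp add: \<phi>'_def)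
  qed
  have "norm (\<phi> (x + 1) - \<phi> x) \<le> B * \<bar>x + 1 - x\<bar>"
    by (rule norm_diff_le_vector_derivative[OF d1 b1]) auto
  then show ?thesis
    by (simp add: \<phi>_def trapezoid_error_def)
qed

lemma has_vector_derivative_of_real_powr:
  assumes "t > 0"
  shows "((\<lambda>t. complex_of_real t powr s) has_vector_derivative s * of_real t powr (s - 1)) (at t within A)"
  using assms by (intro has_vector_derivative_real_field has_field_derivative_powr) auto

definition power_trapezoid_error :: "complex \<Rightarrow> real \<Rightarrow> complex" where
  "power_trapezoid_error s =
     trapezoid_error (\<lambda>x. of_real x powr (1 - s) / (1 - s)) (\<lambda>x. of_real x powr (- s))"

lemma norm_power_trapezoid_error_le:
  assumes s: "Re s > -2" "s \<noteq> 1" and x: "x > 0"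
  shows "norm (power_trapezoid_error s x) \<le> norm (s * (s + 1)) * x powr (- Re s - 2)"
  unfolding power_trapezoid_error_def
proof (rule norm_trapezoid_error_le)
  fix t assume t: "t \<in> {x..x+1}"
  then have t0: "t > 0"
    using x by simp
  have s1: "1 - s \<noteq> 0"
    using s by simp
  show "((\<lambda>x. of_real x powr (1 - s) / (1 - s)) has_vector_derivative of_real t powr (- s)) (at t within {x..x+1})"
    using has_vector_derivative_divide[OF has_vector_derivative_of_real_powr[OF t0, of "1 - s"], of "1 - s"] s1
    by simp
  show "((\<lambda>x. of_real x powr (- s)) has_vector_derivative - s * of_real t powr (- s - 1)) (at t within {x..x+1})"
    by (rule has_vector_derivative_of_real_powr[OF t0])
  show "((\<lambda>x. - s * of_real x powr (- s - 1)) has_vector_derivative - s * ((- s - 1) * of_real t powr (- s - 1 - 1)))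
      (at t within {x..x+1})"
    by (intro has_vector_derivative_mult_right has_vector_derivative_of_real_powr[OF t0])
  have "norm (- s * ((- s - 1) * of_real t powr (- s - 1 - 1))) = norm (s * (s + 1)) * t powr (- Re s - 2)"
  proof -
    have "- s * ((- s - 1) * of_real t powr (- s - 1 - 1)) = s * (s + 1) * of_real t powr (- s - 1 - 1)"
      by (simp add: algebra_simps)
    moreover have "norm (complex_of_real t powr (- s - 1 - 1)) = t powr (- Re s - 2)"
      using t0 by (subst norm_powr_real_powr) (auto simp: minus_diff_commute)
    ultimately show ?thesis
      by (simp only: norm_mult)
  qed
  also have "t powr (- Re s - 2) \<le> x powr (- Re s - 2)"
    using t x s by (intro powr_mono2') auto
  finally show "norm (- s * ((- s - 1) * of_real t powr (- s - 1 - 1))) \<le> norm (s * (s + 1)) * x powr (- Re s - 2)"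
    by (simp add: mult_left_mono)
qed

text \<open>
  Weierstrass' theorem on series of holomorphic functions, with a majorant near each point that may
  fail for finitely many terms.
\<close>

lemma holomorphic_on_suminf:
  fixes f :: "nat \<Rightarrow> complex \<Rightarrow> complex"
  assumes S: "open S" and hol: "\<And>n. f n holomorphic_on S"
    and bound: "\<And>x. x \<in> S \<Longrightarrow> \<exists>d h. 0 < d \<and> summable h \<and>
       (\<forall>\<^sub>F n in sequentially. \<forall>y\<in>ball x d \<inter> S. norm (f n y) \<le> h n)"
  shows "(\<lambda>x. \<Sum>n. f n x) holomorphic_on S"
proof -
  have "\<exists>g g'. \<forall>x \<in> S. ((\<lambda>n. f n x) sums g x) \<and> ((\<lambda>n. deriv (f n) x) sums g' x) \<and> (g has_field_derivative g' x) (at x)"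
    by (rule series_and_derivative_comparison_local[OF S holomorphic_derivI[OF hol S] bound])
  then obtain g g' where g: "\<And>x. x \<in> S \<Longrightarrow> (\<lambda>n. f n x) sums g x"
      "\<And>x. x \<in> S \<Longrightarrow> (g has_field_derivative g' x) (at x)"
    by blast
  have "g holomorphic_on S"
    using g(2) S by (auto simp: holomorphic_on_open)
  then show ?thesis
    by (rule holomorphic_transform) (use g(1) in \<open>auto simp: sums_iff\<close>)
qed

text \<open>
  Euler-Maclaurin summation of \<open>(a + r) powr (-s)\<close> up to the trapezoid correction. The errors decay
  like \<open>r powr (- Re s - 2)\<close>, which is why the series converges as far as \<open>Re s > -1\<close>.
\<close>

definition em_zeta :: "complex \<Rightarrow> real \<Rightarrow> complex" where
  "em_zeta s a = of_real a powr (- s) / 2 - of_real a powr (1 - s) / (1 - s)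
     + (\<Sum>r. power_trapezoid_error s (a + real r))"

lemma summable_power_trapezoid_error_bound:
  assumes "\<sigma> > -1"
  shows "summable (\<lambda>r. C * real r powr (- \<sigma> - 2))"
  using assms by (intro summable_mult) (simp add: summable_real_powr_iff)

lemma norm_power_trapezoid_error_shift_le:
  assumes s: "Re s > -2" "s \<noteq> 1" and a: "a > 0" and r: "r > 0"
  shows "norm (power_trapezoid_error s (a + real r)) \<le> norm (s * (s + 1)) * real r powr (- Re s - 2)"
proof -
  have "(a + real r) powr (- Re s - 2) \<le> real r powr (- Re s - 2)"
    using assms by (intro powr_mono2') auto
  then show ?thesis
    using norm_power_trapezoid_error_le[OF s, of "a + real r"] a
    by (intro order_trans[OF _ mult_left_mono[of _ "real r powr (- Re s - 2)"]]) auto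
qed

lemma summable_power_trapezoid_error:
  assumes s: "Re s > -1" "s \<noteq> 1" and a: "a > 0"
  shows "summable (\<lambda>r. power_trapezoid_error s (a + real r))"
proof (rule summable_comparison_test_ev)
  show "\<forall>\<^sub>F r in sequentially. norm (power_trapezoid_error s (a + real r))
      \<le> norm (s * (s + 1)) * real r powr (- Re s - 2)"
    using eventually_gt_at_top[of 0]
    by eventually_elim (use norm_power_trapezoid_error_shift_le s a in auto)
qed (rule summable_power_trapezoid_error_bound[OF s(1)])

lemma em_zeta_holomorphic:
  assumes a: "a > 0"
  shows "(\<lambda>s. em_zeta s a) holomorphic_on ({s. Re s > -1} - {1})"
proof -
  let ?S = "{s. Re s > -1} - {1 :: complex}"
  have S: "open ?S"
    by (intro open_Diff open_halfspace_Re_gt) auto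
  have "(\<lambda>s. \<Sum>r. power_trapezoid_error s (a + real r)) holomorphic_on ?S"
  proof (rule holomorphic_on_suminf[OF S])
    show "(\<lambda>s. power_trapezoid_error s (a + real r)) holomorphic_on ?S" for r
      unfolding power_trapezoid_error_def trapezoid_error_def scaleR_conv_of_real
      using a by (intro holomorphic_intros) (auto simp: add_nonneg_eq_0_iff complex_nonpos_Reals_iff)
    fix s0 assume s0: "s0 \<in> ?S"
    \<comment> \<open>On the disc of radius \<open>d\<close> about \<open>s0\<close>, the real part stays above \<open>\<sigma> > -1\<close>.\<close>
    define d where "d = (Re s0 + 1) / 2"
    define M where "M = (norm s0 + d) * (norm s0 + d + 1)"
    define \<sigma> where "\<sigma> = (Re s0 - 1) / 2"
    have d: "d > 0"
      using s0 by (simp add: d_def)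
    have "norm (power_trapezoid_error s (a + real r)) \<le> M * real r powr (- \<sigma> - 2)"
      if r: "r > 0" and s: "s \<in> ball s0 d \<inter> ?S" for r s
    proof -
      have ns: "norm s \<le> norm s0 + d"
        using s norm_triangle_ineq2[of s s0] by (simp add: dist_norm norm_minus_commute)
      have "\<bar>Re s0 - Re s\<bar> < d"
        using s abs_Re_le_cmod[of "s0 - s"] by (simp add: dist_norm)
      then have "Re s > Re s0 - d"
        by linarith
      then have \<sigma>: "Re s > \<sigma>"
        by (simp add: d_def \<sigma>_def field_simps)
      have "norm (s + 1) \<le> norm s0 + d + 1"
        using ns norm_triangle_ineq[of s 1] by simp
      then have M: "norm (s * (s + 1)) \<le> M"
        unfolding M_def norm_mult using ns d by (intro mult_mono) auto
      have "norm (power_trapezoid_error s (a + real r)) \<le> norm (s * (s + 1)) * real r powr (- Re s - 2)"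
        using s r a by (intro norm_power_trapezoid_error_shift_le) auto
      also have "\<dots> \<le> M * real r powr (- \<sigma> - 2)"
        using M r \<sigma> order_trans[OF norm_ge_zero M] by (intro mult_mono powr_mono) auto
      finally show ?thesis .
    qed
    then have "\<forall>\<^sub>F r in sequentially. \<forall>s\<in>ball s0 d \<inter> ?S.
        norm (power_trapezoid_error s (a + real r)) \<le> M * real r powr (- \<sigma> - 2)"
      by (intro eventually_mono[OF eventually_gt_at_top[of 0]]) blast
    moreover have "summable (\<lambda>r. M * real r powr (- \<sigma> - 2))"
      using s0 by (intro summable_power_trapezoid_error_bound) (auto simp: \<sigma>_def)
    ultimately show "\<exists>d h. 0 < d \<and> summable h \<and> (\<forall>\<^sub>F r in sequentially. \<forall>s\<in>ball s0 d \<inter> ?S.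
        norm (power_trapezoid_error s (a + real r)) \<le> h r)"
      using d by blast
  qed
  then show ?thesis
    unfolding em_zeta_def using a by (intro holomorphic_intros) auto
qed

lemma tendsto_of_real_add_nat_powr_0:
  assumes "Re s < 0" "a > 0"
  shows "(\<lambda>N. complex_of_real (a + real N) powr s) \<longlonglongrightarrow> 0"
proof (rule tendsto_norm_zero_cancel)
  have "filterlim (\<lambda>N. a + real N) at_top sequentially"
    by (intro filterlim_tendsto_add_at_top[OF tendsto_const] filterlim_real_sequentially)
  then have "(\<lambda>N. (a + real N) powr Re s) \<longlonglongrightarrow> 0"
    using assms by (intro tendsto_neg_powr)
  also have "(\<lambda>N. (a + real N) powr Re s) = (\<lambda>N. norm (complex_of_real (a + real N) powr s))"
    using assms by (intro ext, subst norm_powr_real_powr) auto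
  finally show "(\<lambda>N. norm (complex_of_real (a + real N) powr s)) \<longlonglongrightarrow> 0" .
qed

lemma em_zeta_eq_dirichlet_series:
  assumes s: "Re s > 1" and a: "a > 0"
  shows "(\<lambda>r. complex_of_real (a + real r) powr (- s)) sums em_zeta s a"
proof -
  have s1: "s \<noteq> 1"
    using s by auto
  have "(\<lambda>N. (\<Sum>r<N. power_trapezoid_error s (a + real r))
        - (1 / 2) *\<^sub>R (of_real (a + real N) powr (- s) - of_real a powr (- s))
        + (of_real (a + real N) powr (1 - s) / (1 - s) - of_real a powr (1 - s) / (1 - s)))
     \<longlonglongrightarrow> (\<Sum>r. power_trapezoid_error s (a + real r))
        - (1 / 2) *\<^sub>R (0 - of_real a powr (- s)) + (0 / (1 - s) - of_real a powr (1 - s) / (1 - s))"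
    using s s1 a
    by (intro tendsto_intros tendsto_of_real_add_nat_powr_0 summable_LIMSEQ summable_power_trapezoid_error) auto
  then show ?thesis
    unfolding sums_def power_trapezoid_error_def sum_trapezoid_error em_zeta_def
    by (simp add: scaleR_conv_of_real algebra_simps)
qed

section \<open>Fourier inversion on the unit interval\<close>

text \<open>
  A continuous function on the unit interval with equal values at the end points factors
  continuously through the circle. This is the transition from loops to circle maps, applied to
  the trivial homotopy of \<open>h\<close> with itself.
\<close>

lemma continuous_on_circle_from_loop:
  fixes h :: "real \<Rightarrow> 'a::real_normed_vector"
  assumes "continuous_on {0..1} h" "h 0 = h 1"
  shows "continuous_on (sphere 0 1) (h \<circ> (\<lambda>z::complex. Arg2pi z / (2 * pi)))"
proof -
  have "homotopic_loops UNIV h h"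
    using assms by (simp add: homotopic_loops_refl path_def pathstart_def pathfinish_def)
  from homotopic_loops_imp_homotopic_circlemaps[OF this] show ?thesis
    by (auto dest: homotopic_with_imp_continuous)
qed

lemma integral_of_real_continuous:
  fixes f :: "real \<Rightarrow> real"
  assumes "continuous_on {a..b} f"
  shows "integral {a..b} (\<lambda>t. complex_of_real (f t)) = of_real (integral {a..b} f)"
  using integral_linear[OF integrable_continuous_real[OF assms] bounded_linear_of_real[where 'a=complex]]
  by (simp add: o_def)

definition fourier_mode :: "int \<Rightarrow> real \<Rightarrow> complex" where
  "fourier_mode k t = cis (2 * pi * of_int k * t)"

lemma fourier_mode_mult: "fourier_mode k t * fourier_mode l t = fourier_mode (k + l) t"
  by (simp add: fourier_mode_def cis_mult algebra_simps)

lemma fourier_mode_0 [simp]: "fourier_mode 0 t = 1"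
  by (simp add: fourier_mode_def)

lemma norm_fourier_mode [simp]: "norm (fourier_mode k t) = 1"
  by (simp add: fourier_mode_def)

lemma cnj_fourier_mode: "cnj (fourier_mode k t) = fourier_mode (- k) t"
  by (simp add: fourier_mode_def cis_cnj)

lemma continuous_on_fourier_mode [continuous_intros]: "continuous_on A (fourier_mode k)"
  unfolding fourier_mode_def by (intro continuous_intros)

lemma fourier_mode_add_nat: "fourier_mode k (t + real r) = fourier_mode k t"
proof -
  have "cis (2 * pi * of_int k * real r) = cis (2 * pi * of_int (k * int r))"
    by (simp add: algebra_simps)
  also have "\<dots> = 1"
    by (rule cis_multiple_2pi) simp
  finally show ?thesis
    by (simp add: fourier_mode_def distrib_left flip: cis_mult)
qed

lemma integral_fourier_mode:
  "integral {0..1} (fourier_mode k) = (if k = 0 then 1 else 0)"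
proof (cases "k = 0")
  case False
  let ?c = "2 * pi * of_int k * \<i>"
  have "(fourier_mode k has_integral fourier_mode k 1 / ?c - fourier_mode k 0 / ?c) {0..1}"
  proof (rule fundamental_theorem_of_calculus)
    show "((\<lambda>t. fourier_mode k t / ?c) has_vector_derivative fourier_mode k t) (at t within {0..1})" for t
    proof -
      have "((\<lambda>z. exp (?c * z) / ?c) has_field_derivative exp (?c * of_real t)) (at (of_real t))"
        using False by (auto intro!: derivative_eq_intros)
      from has_vector_derivative_real_field[OF this] show ?thesis
        by (simp add: fourier_mode_def cis_conv_exp mult_ac)
    qed
  qed simp
  moreover have "fourier_mode k 1 = fourier_mode k 0"
    using fourier_mode_add_nat[of k 0 1] by simp
  ultimately show ?thesis
    using False by (simp add: integral_unique)
next
  case True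
  then have "fourier_mode k = (\<lambda>_. 1)"
    by (simp add: fun_eq_iff)
  with True show ?thesis
    by simp
qed

text \<open>
  Continuity is included so that the integrals are additive; together the two conditions are
  preserved by multiplication with trigonometric polynomials.
\<close>

definition fourier_null :: "(real \<Rightarrow> complex) \<Rightarrow> bool" where
  "fourier_null u \<longleftrightarrow> continuous_on {0..1} u \<and>
     (\<forall>k. integral {0..1} (\<lambda>t. u t * fourier_mode k t) = 0)"

lemma fourier_null_add:
  assumes "fourier_null u" "fourier_null v"
  shows "fourier_null (\<lambda>t. u t + v t)"
  using assms unfolding fourier_null_def distrib_right
  by (intro conjI allI continuous_intros; (subst integral_add)?)
    (auto intro!: continuous_intros integrable_continuous_real)

lemma fourier_null_cmult:
  assumes "fourier_null u"
  shows "fourier_null (\<lambda>t. c * u t)"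
  using assms unfolding fourier_null_def mult.assoc
  by (auto intro!: continuous_intros)

lemma fourier_null_mode:
  assumes "fourier_null u"
  shows "fourier_null (\<lambda>t. u t * fourier_mode l t)"
  using assms unfolding fourier_null_def mult.assoc fourier_mode_mult
  by (auto intro!: continuous_intros)

text \<open>
  Induction over the polynomial, for all \<open>u\<close> at once: on the circle, a linear form is a
  combination of the modes \<open>1\<close> and \<open>-1\<close>, multiplication by which only shifts Fourier coefficients; and
  multiplication by a product is multiplication by one factor after the other.
\<close>

lemma fourier_null_polynomial:
  assumes "real_polynomial_function q" and "fourier_null u"
  shows "fourier_null (\<lambda>t. u t * of_real (q (fourier_mode 1 t)))"
  using assms
proof (induction arbitrary: u rule: real_polynomial_function.induct)
  case (linear q)
  \<comment> \<open>A real linear form is a complex combination of \<open>z\<close> and \<open>cnj z\<close>, and on the circle \<open>cnj z\<close> is the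
    mode \<open>-1\<close>.\<close>
  define a b where "a = complex_of_real (q 1) / 2 + of_real (q \<i>) / (2 * \<i>)"
    and "b = complex_of_real (q 1) / 2 - of_real (q \<i>) / (2 * \<i>)"
  have q: "complex_of_real (q z) = a * z + b * cnj z" for z
  proof -
    have "q z = q (Re z *\<^sub>R 1 + Im z *\<^sub>R \<i>)"
      by (simp add: scaleR_conv_of_real complex_eq mult.commute flip: complex_eq)
    also have "\<dots> = Re z * q 1 + Im z * q \<i>"
      using linear(1) by (simp only: linear_simps real_scaleR_def)
    finally show ?thesis
      by (simp add: a_def b_def complex_eq_iff)
  qed
  have "(\<lambda>t. u t * of_real (q (fourier_mode 1 t)))
    = (\<lambda>t. a * (u t * fourier_mode 1 t) + b * (u t * fourier_mode (- 1) t))"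
    by (auto simp: q cnj_fourier_mode algebra_simps)
  then show ?case
    by (simp only:) (intro fourier_null_add fourier_null_cmult fourier_null_mode linear)
next
  case (const c)
  then show ?case
    using fourier_null_cmult[of u "of_real c"] by (simp add: mult.commute)
next
  case (add p q)
  then show ?case
    by (simp add: distrib_left fourier_null_add)
next
  case (mult p q)
  from mult.IH(2)[OF mult.IH(1)[OF mult.prems]] show ?case
    by (simp add: mult.assoc)
qed

text \<open>
  By Stone-Weierstrass, \<open>h\<close> is a uniform limit of polynomials on the circle. It is orthogonal to all
  of them, hence to itself.
\<close>

lemma fourier_uniqueness:
  fixes h :: "real \<Rightarrow> real"
  assumes null: "fourier_null (\<lambda>t. of_real (h t))" and "h 0 = h 1" and t: "t \<in> {0..1}"
  shows "h t = 0"
proof -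
  have cont: "continuous_on {0..1} h"
    using null by (simp add: fourier_null_def)
  let ?H = "h \<circ> (\<lambda>z::complex. Arg2pi z / (2 * pi))"
  have contH: "continuous_on (sphere 0 1) ?H"
    using continuous_on_circle_from_loop[OF cont \<open>h 0 = h 1\<close>] .
  have H: "?H (fourier_mode 1 t) = h t" if "t \<in> {0..1}" for t
  proof (cases "t = 1")
    case True
    then show ?thesis
      using fourier_mode_add_nat[of 1 0 1] \<open>h 0 = h 1\<close> Arg2pi_of_real[of 1]
      by (simp add: fourier_mode_def)
  next
    case False
    then have "Arg2pi (fourier_mode 1 t) = 2 * pi * t"
      using that Arg2pi_exp[of "\<i> * of_real (2 * pi * t)"] by (simp add: fourier_mode_def cis_conv_exp)
    then show ?thesis
      by simp
  qed
  obtain B where B: "B > 0" "\<And>t. t \<in> {0..1} \<Longrightarrow> \<bar>h t\<bar> \<le> B"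
  proof -
    have "bounded (h ` {0..1})"
      using cont by (simp add: compact_continuous_image compact_imp_bounded)
    then show ?thesis
      using that by (auto simp: bounded_pos)
  qed
  have small: "integral {0..1} (\<lambda>t. h t * h t) \<le> e" if e: "e > 0" for e
  proof -
    obtain q where q: "real_polynomial_function q" "\<And>z. z \<in> sphere 0 1 \<Longrightarrow> \<bar>?H z - q z\<bar> < e / B"
      using Stone_Weierstrass_real_polynomial_function[OF _ contH, of "e / B"] e B(1) by auto
    let ?q = "\<lambda>t. q (fourier_mode 1 t)"
    have close: "\<bar>h t - ?q t\<bar> < e / B" if "t \<in> {0..1}" for t
      using q(2)[of "fourier_mode 1 t"] H[OF that] by simp
    from fourier_null_polynomial[OF q(1) null]
    have "fourier_null (\<lambda>t. of_real (h t * ?q t))"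
      by simp
    then have cq: "continuous_on {0..1} (\<lambda>t. h t * ?q t)"
      and iq: "integral {0..1} (\<lambda>t. complex_of_real (h t * ?q t)) = 0"
      unfolding fourier_null_def by (auto dest: spec[of _ 0] simp del: of_real_mult)
    have "integral {0..1} (\<lambda>t. h t * ?q t) = 0"
      using iq by (simp only: integral_of_real_continuous[OF cq] of_real_eq_0_iff)
    then have "integral {0..1} (\<lambda>t. h t * h t) = integral {0..1} (\<lambda>t. h t * h t - h t * ?q t)"
      by (subst integral_diff) (auto intro!: integrable_continuous_real continuous_intros cont cq)
    also have "\<dots> \<le> integral {0..1} (\<lambda>t::real. e)"
    proof (rule integral_le)
      show "(\<lambda>t. h t * h t - h t * ?q t) integrable_on {0..1}"
        by (intro integrable_continuous_real continuous_intros cont cq)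
      fix t :: real assume t: "t \<in> {0..1}"
      have "h t * h t - h t * ?q t \<le> \<bar>h t\<bar> * \<bar>h t - ?q t\<bar>"
        unfolding right_diff_distrib[symmetric] abs_mult[symmetric] by simp
      also have "\<dots> \<le> B * (e / B)"
        using B close[OF t] t by (intro mult_mono) (auto intro: less_imp_le)
      finally show "h t * h t - h t * ?q t \<le> e"
        using B(1) by simp
    qed (intro integrable_continuous_real continuous_intros)
    finally show ?thesis by simp
  qed
  have "integral {0..1} (\<lambda>t. h t * h t) = 0"
  proof (rule antisym)
    show "integral {0..1} (\<lambda>t. h t * h t) \<le> 0"
    proof (rule field_le_epsilon)
      fix e :: real assume "e > 0"
      from small[OF this] show "integral {0..1} (\<lambda>t. h t * h t) \<le> 0 + e"
        by (simp only: add_0_left)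
    qed
    show "integral {0..1} (\<lambda>t. h t * h t) \<ge> 0"
      by (intro integral_nonneg integrable_continuous_real continuous_intros cont) simp
  qed
  then have "\<forall>t\<in>{0..1}. h t * h t = 0"
    by (subst (asm) integral_eq_0_iff) (auto intro!: continuous_intros cont)
  with t show ?thesis by simp
qed

text \<open>
  The series converges uniformly, so it has the same Fourier coefficients as \<open>g\<close>, and uniqueness
  applies to the difference. As \<open>g\<close> is real, the coefficients of negative index are the conjugates of
  those of positive index; the two together give twice the real part.
\<close>

lemma fourier_inversion:
  fixes g :: "real \<Rightarrow> real" and c :: "nat \<Rightarrow> complex"
  assumes cont: "continuous_on {0..1} g" and loop: "g 0 = g 1"
    and c: "\<And>n. integral {0..1} (\<lambda>t. of_real (g t) * fourier_mode (- int n) t) = c n"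
    and summ: "summable (\<lambda>n. norm (c n))" and t: "t \<in> {0..1}"
  shows "(\<lambda>n. 2 * Re (c (Suc n) * fourier_mode (int (Suc n)) t)) sums (g t - Re (c 0))"
proof -
  define T where "T n t = 2 * Re (c (Suc n) * fourier_mode (int (Suc n)) t)" for n t
  define S where "S t = Re (c 0) + (\<Sum>n. T n t)" for t
  have bound: "norm (T n t) \<le> 2 * norm (c (Suc n))" for n t
    using abs_Re_le_cmod[of "c (Suc n) * fourier_mode (int (Suc n)) t"] by (simp add: T_def norm_mult)
  have summ': "summable (\<lambda>n. 2 * norm (c (Suc n)))"
    using summ summable_Suc_iff[of "\<lambda>n. norm (c n)"] by (intro summable_mult) simp
  have ulim: "uniform_limit A (\<lambda>N t. \<Sum>n<N. T n t) (\<lambda>t. \<Sum>n. T n t) sequentially" for A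
    by (rule Weierstrass_m_test[OF bound summ'])
  have ulimS: "uniform_limit A (\<lambda>N t. Re (c 0) + (\<Sum>n<N. T n t)) S sequentially" for A
    unfolding S_def by (intro uniform_limit_intros ulim)
  have contT: "continuous_on A (T n)" for n A
    unfolding T_def by (intro continuous_intros)
  have contS: "continuous_on {0..1} S"
    by (rule uniform_limit_theorem[OF _ ulimS]) (auto intro!: always_eventually continuous_intros contT)
  have c0: "c 0 = of_real (Re (c 0))"
    unfolding c[symmetric] by (simp add: integral_of_real_continuous cont)
  have coeff: "integral {0..1} (\<lambda>t. of_real (S t) * fourier_mode (- int m) t) = c m" for m
  proof -
    have T: "complex_of_real (T n t) = c (Suc n) * fourier_mode (int (Suc n)) t
        + cnj (c (Suc n)) * fourier_mode (- int (Suc n)) t" for n t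
      unfolding T_def
      by (subst complex_add_cnj[symmetric]) (simp only: complex_cnj_mult cnj_fourier_mode)
    have intT: "integral {0..1} (\<lambda>t. of_real (T n t) * fourier_mode (- int m) t)
        = (if m = Suc n then c m else 0)" for n
    proof -
      have "(\<lambda>t. of_real (T n t) * fourier_mode (- int m) t)
        = (\<lambda>t. c (Suc n) * fourier_mode (int (Suc n) - int m) t
            + cnj (c (Suc n)) * fourier_mode (- int (Suc n) - int m) t)"
        by (simp only: T distrib_right mult.assoc fourier_mode_mult) simp
      then show ?thesis
        by (simp only:)
          (subst integral_add; auto intro!: integrable_continuous_real continuous_intros simp: integral_fourier_mode)
    qed
    have intp: "integral {0..1} (\<lambda>t. of_real (Re (c 0) + (\<Sum>n<N. T n t)) * fourier_mode (- int m) t) = c m"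
      if N: "m < N" for N
    proof -
      have "(\<lambda>t. of_real (Re (c 0) + (\<Sum>n<N. T n t)) * fourier_mode (- int m) t)
          = (\<lambda>t. c 0 * fourier_mode (- int m) t + (\<Sum>n<N. of_real (T n t) * fourier_mode (- int m) t))"
        by (subst (2) c0) (simp only: of_real_add of_real_sum distrib_right sum_distrib_right)
      moreover have "integral {0..1} (\<lambda>t. c 0 * fourier_mode (- int m) t + (\<Sum>n<N. of_real (T n t) * fourier_mode (- int m) t))
         = c 0 * (if m = 0 then 1 else 0) + (\<Sum>n<N. if m = Suc n then c m else 0)"
        by (subst integral_add, (intro integrable_continuous_real continuous_intros contT)+,
            subst integral_sum)
           (auto intro!: integrable_continuous_real continuous_intros contT simp: intT integral_fourier_mode simp del: of_real_mult)
      moreover have "(\<Sum>n<N. if m = Suc n then c m else 0) = (if m = 0 then 0 else c m)"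
        using N by (cases m) (auto simp: if_distrib[of "\<lambda>b. if b then _ else _"] sum.delta' cong: if_cong)
      ultimately show ?thesis by auto
    qed
    have "uniform_limit {0..1} (\<lambda>N t. of_real (Re (c 0) + (\<Sum>n<N. T n t)) * fourier_mode (- int m) t)
        (\<lambda>t. of_real (S t) * fourier_mode (- int m) t) sequentially"
    proof (rule uniform_lim_mult)
      show "uniform_limit {0..1} (\<lambda>N t. complex_of_real (Re (c 0) + (\<Sum>n<N. T n t))) (\<lambda>t. of_real (S t)) sequentially"
        by (rule bounded_linear.uniform_limit[OF bounded_linear_of_real ulimS])
      show "bounded ((\<lambda>t. complex_of_real (S t)) ` {0..1})"
        using contS by (intro compact_imp_bounded compact_continuous_image continuous_intros) auto
    qed (auto simp: bounded_iff intro: uniform_limit_const)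
    then obtain I J where IJ: "\<And>N. ((\<lambda>t. of_real (Re (c 0) + (\<Sum>n<N. T n t)) * fourier_mode (- int m) t) has_integral I N) {0..1}"
        "((\<lambda>t. of_real (S t) * fourier_mode (- int m) t) has_integral J) {0..1}" "I \<longlonglongrightarrow> J"
      by (rule uniform_limit_integral) (auto intro!: continuous_intros contT)
    have "I N = c m" if "m < N" for N
      using intp[OF that] integral_unique[OF IJ(1)] by simp
    then have "I \<longlonglongrightarrow> c m"
      by (intro tendsto_eventually eventually_sequentiallyI[of "Suc m"]) auto
    then show ?thesis
      using IJ(2,3) LIMSEQ_unique integral_unique by blast
  qed
  let ?h = "\<lambda>t. g t - S t"
  have neg: "integral {0..1} (\<lambda>t. of_real (?h t) * fourier_mode (- int m) t) = 0" for m
    unfolding of_real_diff left_diff_distrib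
    by (subst integral_diff) (auto intro!: integrable_continuous_real continuous_intros cont contS simp: c coeff)
  have "fourier_null (\<lambda>t. of_real (?h t))"
    unfolding fourier_null_def
  proof (intro conjI allI)
    show "continuous_on {0..1} (\<lambda>t. complex_of_real (?h t))"
      by (intro continuous_intros cont contS)
    fix k :: int
    show "integral {0..1} (\<lambda>t. of_real (?h t) * fourier_mode k t) = 0"
    proof (cases "k \<le> 0")
      case True
      then show ?thesis
        using neg[of "nat (- k)"] by simp
    next
      case False
      have "integral {0..1} (\<lambda>t. of_real (?h t) * fourier_mode k t)
          = integral {0..1} (\<lambda>t. cnj (of_real (?h t) * fourier_mode (- int (nat k)) t))"
        using False by (simp add: cnj_fourier_mode)
      also have "\<dots> = 0"
        by (simp only: integral_cnj[symmetric] neg) simp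
      finally show ?thesis .
    qed
  qed
  moreover have "S 0 = S 1"
    using fourier_mode_add_nat[of _ 0 1] by (simp add: S_def T_def)
  ultimately have "?h t = 0"
    using loop t by (intro fourier_uniqueness) auto
  moreover have "summable (\<lambda>n. T n t)"
    by (rule summable_comparison_test'[OF summ']) (rule bound)
  ultimately show ?thesis
    unfolding S_def sums_iff T_def by simp
qed

section \<open>The Laplace transform of a real power\<close>

lemma Gamma_integral_tendsto:
  fixes p :: real
  assumes p: "p > 0"
  shows "((\<lambda>X. integral {0..X} (\<lambda>x. x powr p * exp (- x))) \<longlongrightarrow> Gamma (1 + p)) at_top"
proof (rule tendstoI)
  fix e :: real assume e: "e > 0"
  let ?f = "\<lambda>x::real. x powr p * exp (- x)"
  have "(?f has_integral Gamma (1 + p)) {0..}"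
    using Gamma_integral_real[of "1 + p"] p by (simp add: exp_minus divide_inverse)
  then obtain B where B: "B > 0" "\<And>a b. ball 0 B \<subseteq> cbox a b \<Longrightarrow>
      norm (integral (cbox a b) (\<lambda>x. if x \<in> {0..} then ?f x else 0) - Gamma (1 + p)) < e"
    using e unfolding has_integral_alt' by meson
  show "\<forall>\<^sub>F X in at_top. dist (integral {0..X} ?f) (Gamma (1 + p)) < e"
    using eventually_ge_at_top[of B]
  proof eventually_elim
    case (elim X)
    have "ball 0 B \<subseteq> cbox (- X) X"
      using elim by (auto simp: dist_real_def)
    from B(2)[OF this] have "norm (integral {-X..X} (\<lambda>x. if x \<in> {0..} then ?f x else 0) - Gamma (1 + p)) < e"
      by simp
    also have "integral {-X..X} (\<lambda>x. if x \<in> {0..} then ?f x else 0) = integral ({0..} \<inter> {-X..X}) ?f"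
      by (rule integral_restrict_Int)
    also have "{0..} \<inter> {-X..X} = {0..X}"
      using elim B(1) by auto
    finally show ?case
      by (simp add: dist_norm)
  qed
qed

lemma continuous_on_powr_mult_exp:
  assumes "p > (0::real)"
  shows "continuous_on {0..} (\<lambda>x. x powr p * exp (- \<epsilon> * x))"
  using assms by (auto intro!: continuous_intros continuous_on_powr')

lemma Gamma_integral_scaled_tendsto:
  fixes p \<epsilon> :: real
  assumes p: "p > 0" and \<epsilon>: "\<epsilon> > 0"
  shows "((\<lambda>X. integral {0..X} (\<lambda>x. x powr p * exp (- \<epsilon> * x)))
      \<longlongrightarrow> Gamma (1 + p) * \<epsilon> powr (- 1 - p)) at_top"
proof -
  let ?G = "\<lambda>X. integral {0..X} (\<lambda>x. x powr p * exp (- x))"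
  have lim: "filterlim (\<lambda>X. \<epsilon> * X) at_top at_top"
    using \<epsilon> by real_asymp
  have "((\<lambda>X. ?G (\<epsilon> * X) * \<epsilon> powr (- 1 - p)) \<longlongrightarrow> Gamma (1 + p) * \<epsilon> powr (- 1 - p)) at_top"
    by (intro tendsto_intros filterlim_compose[OF Gamma_integral_tendsto[OF p] lim])
  then show ?thesis
  proof (rule Lim_transform_eventually)
    show "\<forall>\<^sub>F X in at_top. ?G (\<epsilon> * X) * \<epsilon> powr (- 1 - p) = integral {0..X} (\<lambda>x. x powr p * exp (- \<epsilon> * x))"
      using eventually_gt_at_top[of 0]
    proof eventually_elim
      case (elim X)
      have "(\<lambda>x. x powr p * exp (- x)) integrable_on {0..\<epsilon> * X}"
        using continuous_on_powr_mult_exp[OF p, of 1]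
        by (intro integrable_continuous_real) (auto elim: continuous_on_subset)
      from has_integral_stretch_real[OF integrable_integral[OF this], of \<epsilon>] \<epsilon>
      have "((\<lambda>x. (\<epsilon> * x) powr p * exp (- (\<epsilon> * x))) has_integral (1 / \<epsilon>) * ?G (\<epsilon> * X)) ((\<lambda>x. x / \<epsilon>) ` {0..\<epsilon> * X})"
        by simp
      also have "(\<lambda>x. x / \<epsilon>) ` {0..\<epsilon> * X} = {0..X}"
        using \<epsilon> elim by simp
      finally have "((\<lambda>x. \<epsilon> powr (- p) * ((\<epsilon> * x) powr p * exp (- (\<epsilon> * x)))) has_integral
          \<epsilon> powr (- p) * ((1 / \<epsilon>) * ?G (\<epsilon> * X))) {0..X}"
        by (rule has_integral_mult_right)
      then have "((\<lambda>x. x powr p * exp (- \<epsilon> * x)) has_integral \<epsilon> powr (- p) * ((1 / \<epsilon>) * ?G (\<epsilon> * X))) {0..X}"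
        by (rule has_integral_cong[THEN iffD1, rotated]) (use \<epsilon> in \<open>auto simp: powr_mult powr_minus field_simps\<close>)
      moreover have "\<epsilon> powr (- 1 - p) = \<epsilon> powr (- p) * (1 / \<epsilon>)"
        using \<epsilon> by (simp add: powr_diff powr_minus field_simps)
      ultimately show ?case
        by (simp add: integral_unique mult_ac)
    qed
  qed
qed

text \<open>
  The integral of \<open>x powr p * exp (- w * x)\<close> over \<open>[r, r + 1]\<close>, moved to the unit interval. Cutting the
  Laplace integral at the natural numbers turns it into a series of entire functions of \<open>w\<close>, and
  matches the unfolding of a sum over \<open>r\<close> of functions on \<open>[0, 1]\<close>.
\<close>

definition laplace_piece :: "real \<Rightarrow> nat \<Rightarrow> complex \<Rightarrow> complex" where
  "laplace_piece p r w =
     integral {0..1} (\<lambda>t. of_real ((t + real r) powr p) * exp (- w * of_real (t + real r)))"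

lemma continuous_on_powr_shift:
  assumes "p > (0::real)"
  shows "continuous_on {0..1} (\<lambda>t. (t + real r) powr p)"
  using assms by (intro continuous_on_powr' continuous_intros) auto

lemma norm_powr_mult_exp_le:
  assumes "p > 0" "\<delta> \<ge> 0" "Re w \<ge> \<delta>" "t \<in> {0..1}"
  shows "norm (complex_of_real ((t + real r) powr p) * exp (- w * of_real (t + real r)))
     \<le> (1 + real r) powr p * exp (- \<delta> * real r)"
proof -
  have "\<delta> * real r \<le> Re w * (t + real r)"
    using assms by (intro mult_mono) auto
  then show ?thesis
    using assms by (auto simp: norm_mult intro!: mult_mono powr_mono2)
qed

lemma summable_powr_mult_exp:
  assumes "\<delta> > (0::real)"
  shows "summable (\<lambda>r. (1 + real r) powr p * exp (- \<delta> * real r))"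
proof (rule summable_comparison_test_bigo)
  show "summable (\<lambda>r. norm (real r powr (- 2)))"
    by (simp add: summable_real_powr_iff)
  show "(\<lambda>r. (1 + real r) powr p * exp (- \<delta> * real r)) \<in> O(\<lambda>r. real r powr (- 2))"
    using assms by real_asymp
qed

lemma norm_laplace_piece_le:
  assumes "p > 0" "\<delta> \<ge> 0" "Re w \<ge> \<delta>"
  shows "norm (laplace_piece p r w) \<le> (1 + real r) powr p * exp (- \<delta> * real r)"
proof -
  have "norm (laplace_piece p r w) \<le> (1 + real r) powr p * exp (- \<delta> * real r) * (1 - 0)"
    unfolding laplace_piece_def
    using norm_powr_mult_exp_le[OF assms]
    by (intro integral_bound continuous_intros continuous_on_powr_shift assms) auto
  then show ?thesis by simp
qed

lemma sum_laplace_piece_real: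
  assumes p: "p > 0"
  shows "(\<Sum>r<N. laplace_piece p r (of_real \<epsilon>)) =
    of_real (integral {0..real N} (\<lambda>x. x powr p * exp (- \<epsilon> * x)))"
proof -
  let ?f = "\<lambda>x. x powr p * exp (- \<epsilon> * x)"
  have int: "?f integrable_on {a..b}" if "a \<ge> 0" for a b
    using that continuous_on_powr_mult_exp[OF p, of \<epsilon>]
    by (intro integrable_continuous_real) (auto elim: continuous_on_subset)
  have piece: "laplace_piece p r (of_real \<epsilon>) = of_real (integral {real r..real r + 1} ?f)" for r
  proof -
    have "((\<lambda>t. ?f (1 * t + real r)) has_integral (1 / 1 ^ 1) *\<^sub>R integral {real r..real r + 1} ?f)
        ((\<lambda>x. (1 / 1) *\<^sub>R x + - ((1 / 1) *\<^sub>R real r)) ` {real r..real r + 1})"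
      using has_integral_affinity[OF integrable_integral[OF int, of "real r" "real r + 1", folded box_real], of 1 "real r"]
      by (simp add: add.commute)
    moreover have "(\<lambda>x. (1 / 1) *\<^sub>R x + - ((1 / 1) *\<^sub>R real r)) ` {real r..real r + 1} = {0..1}"
      by simp
    ultimately have I: "((\<lambda>t. ?f (t + real r)) has_integral integral {real r..real r + 1} ?f) {0..1}"
      by simp
    have "((\<lambda>t. complex_of_real (?f (t + real r))) has_integral of_real (integral {real r..real r + 1} ?f)) {0..1}"
      by (rule has_integral_of_real[OF I])
    then show ?thesis
      unfolding laplace_piece_def by (intro integral_unique) (simp flip: exp_of_real)
  qed
  show ?thesis
  proof (induction N)
    case (Suc N)
    have "integral {0..real N} ?f + integral {real N..real (Suc N)} ?f = integral {0..real (Suc N)} ?f"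
      by (rule Henstock_Kurzweil_Integration.integral_combine) (use int[of 0 "real (Suc N)"] in auto)
    from arg_cong[OF this, of complex_of_real] show ?case
      unfolding sum.lessThan_Suc Suc unfolding piece of_real_add by (simp add: add.commute)
  qed simp
qed

lemma laplace_piece_holomorphic:
  assumes p: "p > 0"
  shows "laplace_piece p r holomorphic_on UNIV"
proof -
  let ?g = "\<lambda>t. complex_of_real ((t + real r) powr p)"
  have g: "continuous_on (UNIV \<times> cbox 0 1) (\<lambda>x::complex \<times> real. ?g (snd x))" using continuous_on_powr_shift[OF p, of r]
    by (intro continuous_on_of_real continuous_on_compose2[OF continuous_on_powr_shift[OF p, of r]] continuous_intros) auto
  have cont: "continuous_on (UNIV \<times> cbox 0 1) (\<lambda>(w::complex, t). ?g t * (exp (- w * of_real (t + real r)) * - of_real (t + real r)))"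
    unfolding split_beta by (intro continuous_on_mult[OF g] continuous_intros)
  have "(\<lambda>w. integral (cbox 0 1) (\<lambda>t. ?g t * exp (- w * of_real (t + real r)))) holomorphic_on UNIV"
  proof (rule leibniz_rule_holomorphic[OF _ _ cont])
    show "(\<lambda>t. ?g t * exp (- w * of_real (t + real r))) integrable_on cbox 0 1" for w
      unfolding box_real by (intro integrable_continuous_real continuous_intros continuous_on_powr_shift p)
  qed (auto intro!: derivative_eq_intros)
  then show ?thesis
    by (simp add: laplace_piece_def[abs_def])
qed

text \<open>
  For positive real \<open>w\<close> this is Euler's integral after a substitution. Both sides are holomorphic in
  the right half-plane, so the identity theorem extends it there, which replaces a rotation of
  the path of integration.
\<close>

lemma laplace_transform_powr:
  assumes p: "p > 0" and w: "Re w > 0"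
  shows "(\<lambda>r. laplace_piece p r w) sums (of_real (Gamma (1 + p)) * w powr of_real (- 1 - p))"
proof -
  let ?S = "{w. Re w > 0}"
  let ?L = "\<lambda>w. \<Sum>r. laplace_piece p r w" and ?R = "\<lambda>w. of_real (Gamma (1 + p)) * w powr complex_of_real (- 1 - p)"
  have summable: "summable (\<lambda>r. laplace_piece p r w)" if "Re w > 0" for w
    using that
    by (intro summable_comparison_test'[OF summable_powr_mult_exp[OF that, of p] norm_laplace_piece_le] p) auto
  have "?L w - ?R w = 0"
  proof (rule analytic_continuation[of "\<lambda>w. ?L w - ?R w" ?S "complex_of_real ` {0<..}" 1])
    have "?L holomorphic_on ?S"
    proof (rule holomorphic_on_suminf[OF open_halfspace_Re_gt])
      show "laplace_piece p r holomorphic_on ?S" for r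
        using laplace_piece_holomorphic[OF p] by (rule holomorphic_on_subset) auto
      fix w0 :: complex assume "w0 \<in> ?S"
      then have \<delta>: "Re w0 / 2 > 0"
        by simp
      have "norm (laplace_piece p r w) \<le> (1 + real r) powr p * exp (- (Re w0 / 2) * real r)"
        if "w \<in> ball w0 (Re w0 / 2)" for r w
      proof -
        have "\<bar>Re w0 - Re w\<bar> < Re w0 / 2"
          using that abs_Re_le_cmod[of "w0 - w"] by (simp add: dist_norm)
        then have "Re w0 / 2 \<le> Re w"
          by linarith
        then show ?thesis
          using \<delta> by (intro norm_laplace_piece_le p) simp_all
      qed
      then show "\<exists>d h. 0 < d \<and> summable h \<and> (\<forall>\<^sub>F r in sequentially. \<forall>y\<in>ball w0 d \<inter> ?S. norm (laplace_piece p r y) \<le> h r)"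
        using \<delta> summable_powr_mult_exp[OF \<delta>, of p] by (intro exI[of _ "Re w0 / 2"] exI conjI) auto
    qed
    then show "(\<lambda>w. ?L w - ?R w) holomorphic_on ?S"
      by (intro holomorphic_intros) (auto simp: complex_nonpos_Reals_iff)
    show "connected ?S"
      by (intro convex_connected convex_halfspace_Re_gt)
    show "1 islimpt complex_of_real ` {0<..}"
    proof -
      have "(1::real) islimpt {0<..}"
        by (intro interior_limit_point) (simp add: interior_open)
      then show ?thesis
        using islimpt_isCont_image[of 1 "{0<..}" complex_of_real]
        by (auto simp: eventually_at_filter)
    qed
    fix z assume "z \<in> complex_of_real ` {0<..}"
    then obtain \<epsilon> where \<epsilon>: "\<epsilon> > 0" "z = of_real \<epsilon>"
      by auto
    have "(\<lambda>N. \<Sum>r<N. laplace_piece p r z) \<longlonglongrightarrow> of_real (Gamma (1 + p) * \<epsilon> powr (- 1 - p))"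
      unfolding \<epsilon>(2) sum_laplace_piece_real[OF p]
      by (intro tendsto_of_real filterlim_compose[OF Gamma_integral_scaled_tendsto[OF p \<epsilon>(1)] filterlim_real_sequentially])
    moreover have "(\<lambda>N. \<Sum>r<N. laplace_piece p r z) \<longlonglongrightarrow> ?L z"
      using summable[of z] \<epsilon> by (intro summable_LIMSEQ) simp
    ultimately have "?L z = of_real (Gamma (1 + p) * \<epsilon> powr (- 1 - p))"
      by (rule LIMSEQ_unique[rotated])
    also have "\<dots> = ?R z"
      using \<epsilon> powr_of_real[of \<epsilon> "- 1 - p"] by simp
    finally show "?L z - ?R z = 0"
      by simp
  qed (use w in \<open>auto intro: open_halfspace_Re_gt\<close>)
  then show ?thesis
    using summable[OF w] by (simp add: sums_iff)
qed

section \<open>Lipschitz's formula\<close>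

definition lerch_sum :: "real \<Rightarrow> real \<Rightarrow> real \<Rightarrow> real" where
  "lerch_sum p \<epsilon> t = (\<Sum>r. (t + real r) powr p * exp (- \<epsilon> * (t + real r)))"

text \<open>
  The Laplace transform of \<open>x powr p\<close> at \<open>\<epsilon> + 2\<pi>in\<close>. It makes sense also for \<open>\<epsilon> = 0\<close> when \<open>n > 0\<close>, which is
  the limit needed later.
\<close>

definition lerch_coeff :: "real \<Rightarrow> real \<Rightarrow> nat \<Rightarrow> complex" where
  "lerch_coeff p \<epsilon> n =
     of_real (Gamma (1 + p)) * (of_real \<epsilon> + 2 * of_real pi * of_nat n * \<i>) powr of_real (- 1 - p)"

lemma norm_lerch_coeff_le:
  assumes "p > 0" "\<epsilon> \<ge> 0" "n > 0"
  shows "norm (lerch_coeff p \<epsilon> n) \<le> Gamma (1 + p) * real n powr (- 1 - p)"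
proof -
  let ?w = "of_real \<epsilon> + 2 * of_real pi * of_nat n * \<i> :: complex"
  have "1 * real n \<le> 2 * pi * real n"
    using pi_gt3 by (intro mult_right_mono) auto
  also have "\<dots> = Im ?w"
    by simp
  also have "\<dots> \<le> norm ?w"
    using abs_Im_le_cmod[of ?w] by linarith
  finally have "norm ?w powr (- 1 - p) \<le> real n powr (- 1 - p)"
    using assms by (intro powr_mono2') auto
  moreover have "norm (?w powr of_real (- 1 - p)) = norm ?w powr (- 1 - p)"
    by (subst norm_powr_real_powr') auto
  moreover have "Gamma (1 + p) > 0"
    using assms by (intro Gamma_real_pos) auto
  ultimately show ?thesis
    unfolding lerch_coeff_def norm_mult by (simp add: mult_left_mono)
qed

lemma summable_lerch_bound:
  assumes "p > 0"
  shows "summable (\<lambda>n. C * real n powr (- 1 - p))"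
  using assms by (intro summable_mult) (simp add: summable_real_powr_iff)

lemma uniform_limit_lerch_sum:
  assumes p: "p > 0" and \<epsilon>: "\<epsilon> > 0"
  shows "uniform_limit {0..1} (\<lambda>N t. \<Sum>r<N. (t + real r) powr p * exp (- \<epsilon> * (t + real r)))
    (lerch_sum p \<epsilon>) sequentially"
  unfolding lerch_sum_def[abs_def]
proof (rule Weierstrass_m_test[OF _ summable_powr_mult_exp[OF \<epsilon>, of p]])
  fix r and t :: real assume t: "t \<in> {0..1}"
  have "norm ((t + real r) powr p * exp (- \<epsilon> * (t + real r)))
     = norm (complex_of_real ((t + real r) powr p) * exp (- of_real \<epsilon> * of_real (t + real r)))"
    by (simp add: norm_mult)
  also have "\<dots> \<le> (1 + real r) powr p * exp (- \<epsilon> * real r)"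
    using p \<epsilon> t by (intro norm_powr_mult_exp_le) auto
  finally show "norm ((t + real r) powr p * exp (- \<epsilon> * (t + real r))) \<le> (1 + real r) powr p * exp (- \<epsilon> * real r)" .
qed

lemma continuous_on_lerch_term:
  assumes p: "p > (0::real)"
  shows "continuous_on {0..1} (\<lambda>t. (t + real r) powr p * exp (- \<epsilon> * (t + real r)))"
  by (intro continuous_on_mult continuous_on_powr_shift p continuous_intros)

lemma continuous_on_lerch_sum:
  assumes p: "p > 0" and \<epsilon>: "\<epsilon> > 0"
  shows "continuous_on {0..1} (lerch_sum p \<epsilon>)"
  by (rule uniform_limit_theorem[OF _ uniform_limit_lerch_sum[OF assms]])
    (intro always_eventually allI continuous_on_sum continuous_on_lerch_term p trivial_limit_sequentially)+

lemma lerch_sum_sums: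
  assumes p: "p > 0" and \<epsilon>: "\<epsilon> > 0" and t: "t \<in> {0..1}"
  shows "(\<lambda>r. (t + real r) powr p * exp (- \<epsilon> * (t + real r))) sums lerch_sum p \<epsilon> t"
  unfolding sums_def by (rule tendsto_uniform_limitI[OF uniform_limit_lerch_sum[OF p \<epsilon>] t])

text \<open>
  The two sums differ by the term \<open>0 powr p\<close>, which is \<open>0\<close>.
\<close>

lemma lerch_sum_loop:
  assumes p: "p > 0" and \<epsilon>: "\<epsilon> > 0"
  shows "lerch_sum p \<epsilon> 0 = lerch_sum p \<epsilon> 1"
proof -
  have "(\<lambda>r. (0 + real (Suc r)) powr p * exp (- \<epsilon> * (0 + real (Suc r)))) sums lerch_sum p \<epsilon> 1"
    using lerch_sum_sums[OF p \<epsilon>, of 1] by (simp add: add.commute)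
  then have "(\<lambda>r. (0 + real r) powr p * exp (- \<epsilon> * (0 + real r))) sums lerch_sum p \<epsilon> 1"
    by (subst (asm) sums_Suc_iff) simp
  then show ?thesis
    by (simp add: lerch_sum_def sums_iff)
qed

text \<open>
  Unfolding: since the modes have period \<open>1\<close>, the integrals over the unit interval of the summands
  are the pieces of one Laplace integral over the half-line.
\<close>

lemma integral_lerch_sum_fourier_mode:
  assumes p: "p > 0" and \<epsilon>: "\<epsilon> > 0"
  shows "integral {0..1} (\<lambda>t. of_real (lerch_sum p \<epsilon> t) * fourier_mode (- int n) t) = lerch_coeff p \<epsilon> n"
proof -
  define w where "w = of_real \<epsilon> + 2 * of_real pi * of_nat n * \<i>"
  let ?f = "\<lambda>r t. (t + real r) powr p * exp (- \<epsilon> * (t + real r))"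
  have mode: "of_real (?f r t) * fourier_mode (- int n) t
      = of_real ((t + real r) powr p) * exp (- w * of_real (t + real r))" for r t
  proof -
    have "fourier_mode (- int n) t = fourier_mode (- int n) (t + real r)"
      by (simp only: fourier_mode_add_nat)
    also have "\<dots> = exp (- (2 * of_real pi * of_nat n * \<i>) * of_real (t + real r))"
      by (simp add: fourier_mode_def cis_conv_exp mult_ac)
    finally have mode: "fourier_mode (- int n) t = \<dots>" .
    have "exp (- w * of_real (t + real r))
        = of_real (exp (- \<epsilon> * (t + real r))) * exp (- (2 * of_real pi * of_nat n * \<i>) * of_real (t + real r))"
      unfolding exp_of_real[symmetric] exp_add[symmetric] w_def
      by (rule arg_cong[of _ _ exp]) (simp add: algebra_simps)
    then show ?thesis
      unfolding mode by (simp only: of_real_mult mult.assoc)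
  qed
  have ulim: "uniform_limit {0..1} (\<lambda>N t. of_real (\<Sum>r<N. ?f r t) * fourier_mode (- int n) t)
      (\<lambda>t. of_real (lerch_sum p \<epsilon> t) * fourier_mode (- int n) t) sequentially"
  proof (rule uniform_lim_mult)
    show "uniform_limit {0..1} (\<lambda>N t. complex_of_real (\<Sum>r<N. ?f r t)) (\<lambda>t. of_real (lerch_sum p \<epsilon> t)) sequentially"
      by (rule bounded_linear.uniform_limit[OF bounded_linear_of_real uniform_limit_lerch_sum[OF assms]])
    show "bounded ((\<lambda>t. complex_of_real (lerch_sum p \<epsilon> t)) ` {0..1})"
      by (intro compact_imp_bounded compact_continuous_image continuous_intros continuous_on_lerch_sum assms) auto
  qed (auto simp: bounded_iff intro: uniform_limit_const)
  have cont: "continuous_on {0..1} (\<lambda>t. of_real (\<Sum>r<N. ?f r t) * fourier_mode (- int n) t)" for N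
    by (rule continuous_on_mult[OF continuous_on_of_real[OF continuous_on_sum[OF continuous_on_lerch_term[OF p]]]
          continuous_on_fourier_mode])
  obtain I J where IJ: "\<And>N. ((\<lambda>t. of_real (\<Sum>r<N. ?f r t) * fourier_mode (- int n) t) has_integral I N) {0..1}"
      "((\<lambda>t. of_real (lerch_sum p \<epsilon> t) * fourier_mode (- int n) t) has_integral J) {0..1}" "I \<longlonglongrightarrow> J"
    by (rule uniform_limit_integral[OF ulim cont]) auto
  have "I = (\<lambda>N. \<Sum>r<N. laplace_piece p r w)"
  proof
    fix N
    have "I N = integral {0..1} (\<lambda>t. \<Sum>r<N. of_real ((t + real r) powr p) * exp (- w * of_real (t + real r)))"
      unfolding mode[symmetric] sum_distrib_right[symmetric] of_real_sum[symmetric]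
      using integral_unique[OF IJ(1)] by simp
    also have "\<dots> = (\<Sum>r<N. laplace_piece p r w)"
      unfolding laplace_piece_def
      by (rule integral_sum) (auto intro!: integrable_continuous_real continuous_on_mult continuous_on_of_real continuous_on_powr_shift p continuous_intros)
    finally show "I N = \<dots>" .
  qed
  then have "(\<lambda>r. laplace_piece p r w) sums J"
    using IJ(3) by (simp add: sums_def)
  moreover have "(\<lambda>r. laplace_piece p r w) sums lerch_coeff p \<epsilon> n"
    unfolding lerch_coeff_def w_def[symmetric] using \<epsilon> by (intro laplace_transform_powr p) (simp add: w_def)
  ultimately show ?thesis
    using IJ(2) integral_unique sums_unique2 by blast
qed

lemma lipschitz_formula:
  assumes p: "p > 0" and \<epsilon>: "\<epsilon> > 0" and t: "t \<in> {0..1}"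
  shows "(\<lambda>n. 2 * Re (lerch_coeff p \<epsilon> (Suc n) * fourier_mode (int (Suc n)) t))
    sums (lerch_sum p \<epsilon> t - Gamma (1 + p) * \<epsilon> powr (- 1 - p))"
proof -
  have "(\<lambda>n. 2 * Re (lerch_coeff p \<epsilon> (Suc n) * fourier_mode (int (Suc n)) t))
    sums (lerch_sum p \<epsilon> t - Re (lerch_coeff p \<epsilon> 0))"
  proof (rule fourier_inversion[OF continuous_on_lerch_sum[OF p \<epsilon>] lerch_sum_loop[OF p \<epsilon>]
        integral_lerch_sum_fourier_mode[OF p \<epsilon>] _ t])
    have "\<forall>\<^sub>F n in sequentially. norm (norm (lerch_coeff p \<epsilon> n)) \<le> Gamma (1 + p) * real n powr (- 1 - p)"
      using eventually_gt_at_top[of 0] by eventually_elim (use p \<epsilon> norm_lerch_coeff_le in auto)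
    then show "summable (\<lambda>n. norm (lerch_coeff p \<epsilon> n))"
      using summable_lerch_bound[OF p] by (rule summable_comparison_test_ev)
  qed
  moreover have "lerch_coeff p \<epsilon> 0 = of_real (Gamma (1 + p) * \<epsilon> powr (- 1 - p))"
    using \<epsilon> powr_of_real[of \<epsilon> "- 1 - p"] by (simp add: lerch_coeff_def)
  ultimately show ?thesis
    by simp
qed

section \<open>Abel summation: removing the exponential damping\<close>

definition damped_power :: "real \<Rightarrow> real \<Rightarrow> real \<Rightarrow> real" where
  "damped_power p \<epsilon> x = x powr p * exp (- \<epsilon> * x)"

definition damped_power_integral :: "real \<Rightarrow> real \<Rightarrow> real \<Rightarrow> real" where
  "damped_power_integral p \<epsilon> x = integral {0..x} (damped_power p \<epsilon>)"

lemma damped_power_integral_has_derivative: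
  assumes p: "p > 0" and x: "x > 0" and t: "t \<in> {x..x+1}"
  shows "(damped_power_integral p \<epsilon> has_vector_derivative damped_power p \<epsilon> t) (at t within {x..x+1})"
proof -
  have "continuous_on {0..x+1} (damped_power p \<epsilon>)"
    using continuous_on_powr_mult_exp[OF p, of \<epsilon>] unfolding damped_power_def[abs_def]
    by (rule continuous_on_subset) auto
  then have "(damped_power_integral p \<epsilon> has_vector_derivative damped_power p \<epsilon> t) (at t within {0..x+1})"
    using t x unfolding damped_power_integral_def[abs_def] by (intro integral_has_vector_derivative) auto
  then show ?thesis
    by (rule has_vector_derivative_within_subset) (use x in auto)
qed

lemma mult_exp_minus_le:
  fixes y :: real
  assumes "y \<ge> 0"
  shows "y * exp (- y) \<le> 1" "y\<^sup>2 * exp (- y) \<le> 2"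
proof -
  have "1 + y + y\<^sup>2 / 2 \<le> exp y"
    using exp_lower_Taylor_quadratic[OF assms] by simp
  then have "y \<le> exp y" "y\<^sup>2 \<le> 2 * exp y"
    using assms by (auto intro: order_trans[OF _ \<open>1 + y + y\<^sup>2 / 2 \<le> exp y\<close>])
  then show "y * exp (- y) \<le> 1" "y\<^sup>2 * exp (- y) \<le> 2"
    by (auto simp: exp_minus field_simps)
qed

text \<open>
  A majorant uniform in \<open>\<epsilon>\<close>. With \<open>y = \<epsilon>t\<close>, the second derivative of the damped power at \<open>t\<close> is
  \<open>t powr (p - 2)\<close> times a combination of \<open>exp (-y)\<close>, \<open>y * exp (-y)\<close> and \<open>y\<^sup>2 * exp (-y)\<close>, all of
  which are bounded for \<open>y \<ge> 0\<close>.
\<close>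

lemma damped_trapezoid_error_le:
  assumes p: "0 < p" "p < 1" and \<epsilon>: "\<epsilon> \<ge> 0" and x: "x > 0"
  shows "\<bar>trapezoid_error (damped_power_integral p \<epsilon>) (damped_power p \<epsilon>) x\<bar> \<le> 5 * x powr (p - 2)"
  unfolding real_norm_def[symmetric]
proof (rule norm_trapezoid_error_le)
  let ?f' = "\<lambda>t. (p * t powr (p - 1) - \<epsilon> * t powr p) * exp (- \<epsilon> * t)"
  let ?f'' = "\<lambda>t. (p * (p - 1) * t powr (p - 2) - 2 * p * \<epsilon> * t powr (p - 1) + \<epsilon>\<^sup>2 * t powr p) * exp (- \<epsilon> * t)"
  fix t assume t: "t \<in> {x..x+1}"
  then have t0: "t > 0"
    using x by simp
  show "(damped_power_integral p \<epsilon> has_vector_derivative damped_power p \<epsilon> t) (at t within {x..x+1})"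
    by (rule damped_power_integral_has_derivative[OF p(1) x t])
  show "(damped_power p \<epsilon> has_vector_derivative ?f' t) (at t within {x..x+1})"
    unfolding has_real_derivative_iff_has_vector_derivative[symmetric] damped_power_def[abs_def]
    using t0 by (auto intro!: derivative_eq_intros simp: algebra_simps)
  have "((\<lambda>t. (p * t powr (p - 1) - \<epsilon> * t powr p) * exp (- \<epsilon> * t)) has_real_derivative ?f'' t) (at t within {x..x+1})"
    using t0 by (auto intro!: derivative_eq_intros simp: algebra_simps power2_eq_square)
  then show "(?f' has_vector_derivative ?f'' t) (at t within {x..x+1})"
    unfolding has_real_derivative_iff_has_vector_derivative .
  define y where "y = \<epsilon> * t"
  have y: "y \<ge> 0"
    using \<epsilon> t0 by (simp add: y_def)
  have pow: "t powr (p - 1) = t powr (p - 2) * t" "t powr p = t powr (p - 2) * t\<^sup>2"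
    using t0 powr_add[of t "p - 2" 1] powr_add[of t "p - 2" 2] by (auto simp: powr_numeral)
  have "?f'' t = t powr (p - 2) * (p * (p - 1) * exp (- y) - 2 * p * (y * exp (- y)) + y\<^sup>2 * exp (- y))"
    unfolding pow y_def by (simp add: algebra_simps power2_eq_square)
  moreover have "\<bar>p * (p - 1) * exp (- y) - 2 * p * (y * exp (- y)) + y\<^sup>2 * exp (- y)\<bar> \<le> 5"
  proof -
    have "\<bar>p * (p - 1) * exp (- y)\<bar> \<le> 1"
      using p y by (simp add: abs_mult mult_le_one)
    moreover have "\<bar>2 * p * (y * exp (- y))\<bar> \<le> 2 * 1 * 1"
      unfolding abs_mult using p y mult_exp_minus_le[OF y] by (intro mult_mono) (auto simp: abs_mult)
    moreover have "\<bar>y\<^sup>2 * exp (- y)\<bar> \<le> 2"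
      using mult_exp_minus_le[OF y] by simp
    ultimately show ?thesis
      by linarith
  qed
  ultimately have "norm (?f'' t) \<le> t powr (p - 2) * 5"
    by (simp add: abs_mult mult_left_mono)
  also have "t powr (p - 2) \<le> x powr (p - 2)"
    using t x p by (intro powr_mono2') auto
  finally show "norm (?f'' t) \<le> 5 * x powr (p - 2)"
    by simp
qed

text \<open>
  Summing the trapezoid errors telescopes the integrals, and the integral over the whole half-line is
  \<open>Gamma (1 + p) * \<epsilon> powr (- 1 - p)\<close>.
\<close>

lemma damped_trapezoid_error_sums:
  assumes p: "p > 0" and \<epsilon>: "\<epsilon> > 0" and a: "0 < a" "a \<le> 1"
  shows "(\<lambda>r. trapezoid_error (damped_power_integral p \<epsilon>) (damped_power p \<epsilon>) (a + real r))
    sums (lerch_sum p \<epsilon> a - Gamma (1 + p) * \<epsilon> powr (- 1 - p)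
       - damped_power p \<epsilon> a / 2 + damped_power_integral p \<epsilon> a)"
proof -
  have lim: "filterlim (\<lambda>N. a + real N) at_top sequentially"
    by (intro filterlim_tendsto_add_at_top[OF tendsto_const] filterlim_real_sequentially)
  have f: "(\<lambda>r. damped_power p \<epsilon> (a + real r)) sums lerch_sum p \<epsilon> a"
    using lerch_sum_sums[OF p \<epsilon>, of a] a by (simp add: damped_power_def)
  then have f0: "(\<lambda>r. damped_power p \<epsilon> (a + real r)) \<longlonglongrightarrow> 0"
    by (intro summable_LIMSEQ_zero) (auto simp: sums_iff)
  have F: "(\<lambda>N. damped_power_integral p \<epsilon> (a + real N)) \<longlonglongrightarrow> Gamma (1 + p) * \<epsilon> powr (- 1 - p)"
    using filterlim_compose[OF Gamma_integral_scaled_tendsto[OF p \<epsilon>] lim]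
    by (simp add: damped_power_integral_def damped_power_def[abs_def])
  have "(\<lambda>N. (\<Sum>r<N. damped_power p \<epsilon> (a + real r)) + (1 / 2) *\<^sub>R (damped_power p \<epsilon> (a + real N) - damped_power p \<epsilon> a)
       - (damped_power_integral p \<epsilon> (a + real N) - damped_power_integral p \<epsilon> a))
     \<longlonglongrightarrow> lerch_sum p \<epsilon> a + (1 / 2) *\<^sub>R (0 - damped_power p \<epsilon> a)
       - (Gamma (1 + p) * \<epsilon> powr (- 1 - p) - damped_power_integral p \<epsilon> a)"
    using f unfolding sums_def by (intro tendsto_intros f0 F)
  then show ?thesis
    unfolding sums_def sum_trapezoid_error by (simp add: algebra_simps)
qed

lemma damped_power_tendsto:
  "((\<lambda>\<epsilon>. damped_power p \<epsilon> x) \<longlongrightarrow> damped_power p 0 x) (at_right 0)"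
  unfolding damped_power_def by (intro tendsto_intros)

lemma damped_power_integral_tendsto:
  assumes p: "p > 0" and x: "x \<ge> 0"
  shows "((\<lambda>\<epsilon>. damped_power_integral p \<epsilon> x) \<longlongrightarrow> damped_power_integral p 0 x) (at_right 0)"
proof -
  have "continuous_on (UNIV \<times> cbox 0 x) (\<lambda>z::real \<times> real. snd z powr p)"
    using p by (intro continuous_on_powr' continuous_intros) auto
  then have "continuous_on (UNIV \<times> cbox 0 x) (\<lambda>(\<epsilon>, t). damped_power p \<epsilon> t)"
    unfolding split_beta damped_power_def by (intro continuous_on_mult) (auto intro!: continuous_intros)
  from integral_continuous_on_param[OF this]
  have "continuous_on UNIV (\<lambda>\<epsilon>. damped_power_integral p \<epsilon> x)"
    by (simp add: damped_power_integral_def)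
  then have "((\<lambda>\<epsilon>. damped_power_integral p \<epsilon> x) \<longlongrightarrow> damped_power_integral p 0 x) (at 0)"
    by (simp add: continuous_on_def)
  then show ?thesis
    by (rule tendsto_mono[OF at_le[OF subset_UNIV]])
qed

lemma damped_power_integral_0:
  assumes p: "p > 0" and x: "x \<ge> 0"
  shows "damped_power_integral p 0 x = x powr (1 + p) / (1 + p)"
proof -
  have "((\<lambda>t. t powr p) has_integral x powr (1 + p) / (1 + p) - 0 powr (1 + p) / (1 + p)) {0..x}"
  proof (rule fundamental_theorem_of_calculus_interior)
    show "continuous_on {0..x} (\<lambda>t. t powr (1 + p) / (1 + p))"
      using p by (intro continuous_on_divide continuous_on_powr' continuous_intros) auto
    fix t assume "t \<in> {0<..<x}"
    then show "((\<lambda>t. t powr (1 + p) / (1 + p)) has_vector_derivative t powr p) (at t)"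
      unfolding has_real_derivative_iff_has_vector_derivative[symmetric]
      using p by (auto intro!: derivative_eq_intros)
  qed (use x in auto)
  then show ?thesis
    unfolding damped_power_integral_def damped_power_def by (simp add: integral_unique)
qed

lemma power_trapezoid_error_of_real:
  assumes p: "p > 0" and x: "x > 0"
  shows "power_trapezoid_error (- of_real p) x
    = of_real (trapezoid_error (damped_power_integral p 0) (damped_power p 0) x)"
proof -
  have "complex_of_real (damped_power p 0 y) = of_real y powr (- (- of_real p))" if "y \<ge> 0" for y
    using that by (simp add: damped_power_def powr_of_real)
  moreover have "complex_of_real (damped_power_integral p 0 y) = of_real y powr (1 - (- of_real p)) / (1 - (- of_real p))"
    if "y \<ge> 0" for y
    using that powr_of_real[of y "1 + p"] by (simp add: damped_power_integral_0 p)
  ultimately show ?thesis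
    using x unfolding power_trapezoid_error_def trapezoid_error_def by (simp add: scaleR_conv_of_real)
qed

lemma lerch_coeff_tendsto:
  assumes "n > 0"
  shows "((\<lambda>\<epsilon>. lerch_coeff p \<epsilon> n) \<longlongrightarrow> lerch_coeff p 0 n) (at_right 0)"
  unfolding lerch_coeff_def using assms
  by (intro tendsto_intros) (auto simp: complex_nonpos_Reals_iff)

lemma eventually_prod_at_top_at_right:
  assumes "\<And>k \<epsilon>. k > 0 \<Longrightarrow> \<epsilon> > 0 \<Longrightarrow> P k \<epsilon>"
  shows "\<forall>\<^sub>F (k, \<epsilon>) in at_top \<times>\<^sub>F at_right (0::real). P (k::nat) \<epsilon>"
  using eventually_prodI[OF eventually_gt_at_top[of 0] eventually_at_right_less[of 0]]
  by eventually_elim (use assms in auto)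

text \<open>
  Both sides are limits as \<open>\<epsilon>\<close> tends to \<open>0\<close> from above of the two sides of Lipschitz's formula: the left
  one through the trapezoid errors \<open>T\<close> of the damped sum, the right one termwise through its
  Fourier series \<open>L\<close>. Tannery's theorem justifies both limits.
\<close>

lemma em_zeta_neg_eq_fourier_series:
  assumes p: "0 < p" "p < 1" and a: "0 < a" "a \<le> 1"
  shows "em_zeta (- of_real p) a = of_real (\<Sum>n. 2 * Re (lerch_coeff p 0 (Suc n) * fourier_mode (int (Suc n)) a))"
proof -
  define T where "T r \<epsilon> = trapezoid_error (damped_power_integral p \<epsilon>) (damped_power p \<epsilon>) (a + real r)" for r \<epsilon>
  define L where "L n \<epsilon> = 2 * Re (lerch_coeff p \<epsilon> (Suc n) * fourier_mode (int (Suc n)) a)" for n \<epsilon>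
  have "((\<lambda>\<epsilon>. \<Sum>r. T r \<epsilon>) \<longlongrightarrow> (\<Sum>r. T r 0)) (at_right 0)"
  proof (rule tannerys_theorem[THEN conjunct2, THEN conjunct2])
    show "((\<lambda>\<epsilon>. T r \<epsilon>) \<longlongrightarrow> T r 0) (at_right 0)" for r
      unfolding T_def trapezoid_error_def using a p
      by (intro tendsto_intros damped_power_tendsto damped_power_integral_tendsto) auto
    show "\<forall>\<^sub>F (r, \<epsilon>) in at_top \<times>\<^sub>F at_right 0. norm (T r \<epsilon>) \<le> 5 * real r powr (- (- p) - 2)"
    proof (rule eventually_prod_at_top_at_right)
      fix r :: nat and \<epsilon> :: real assume r: "r > 0" and \<epsilon>: "\<epsilon> > 0"
      have "norm (T r \<epsilon>) \<le> 5 * (a + real r) powr (p - 2)"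
        unfolding T_def real_norm_def using p a \<epsilon> by (intro damped_trapezoid_error_le) auto
      also have "(a + real r) powr (p - 2) \<le> real r powr (p - 2)"
        using r a p by (intro powr_mono2') auto
      finally show "norm (T r \<epsilon>) \<le> 5 * real r powr (- (- p) - 2)"
        by simp
    qed
    show "summable (\<lambda>r. 5 * real r powr (- (- p) - 2))"
      using p by (intro summable_power_trapezoid_error_bound) auto
  qed simp
  then have lim1: "((\<lambda>\<epsilon>. (\<Sum>r. T r \<epsilon>) + damped_power p \<epsilon> a / 2 - damped_power_integral p \<epsilon> a)
      \<longlongrightarrow> (\<Sum>r. T r 0) + damped_power p 0 a / 2 - damped_power_integral p 0 a) (at_right 0)"
    using a p by (intro tendsto_intros damped_power_tendsto damped_power_integral_tendsto) auto
  have lim2: "((\<lambda>\<epsilon>. (\<Sum>r. T r \<epsilon>) + damped_power p \<epsilon> a / 2 - damped_power_integral p \<epsilon> a)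
      \<longlongrightarrow> (\<Sum>n. L n 0)) (at_right 0)"
  proof (rule Lim_transform_eventually)
    show "((\<lambda>\<epsilon>. \<Sum>n. L n \<epsilon>) \<longlongrightarrow> (\<Sum>n. L n 0)) (at_right 0)"
    proof (rule tannerys_theorem[THEN conjunct2, THEN conjunct2])
      show "((\<lambda>\<epsilon>. L n \<epsilon>) \<longlongrightarrow> L n 0) (at_right 0)" for n
        unfolding L_def by (intro tendsto_intros lerch_coeff_tendsto) simp
      show "\<forall>\<^sub>F (n, \<epsilon>) in at_top \<times>\<^sub>F at_right 0. norm (L n \<epsilon>) \<le> 2 * Gamma (1 + p) * real (Suc n) powr (- 1 - p)"
      proof (rule eventually_prod_at_top_at_right)
        fix n :: nat and \<epsilon> :: real assume \<epsilon>: "\<epsilon> > 0"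
        have "norm (L n \<epsilon>) \<le> 2 * norm (lerch_coeff p \<epsilon> (Suc n))"
          using abs_Re_le_cmod[of "lerch_coeff p \<epsilon> (Suc n) * fourier_mode (int (Suc n)) a"]
          by (simp add: L_def norm_mult)
        also have "norm (lerch_coeff p \<epsilon> (Suc n)) \<le> Gamma (1 + p) * real (Suc n) powr (- 1 - p)"
          using p \<epsilon> by (intro norm_lerch_coeff_le) auto
        finally show "norm (L n \<epsilon>) \<le> 2 * Gamma (1 + p) * real (Suc n) powr (- 1 - p)"
          by simp
      qed
      show "summable (\<lambda>n. 2 * Gamma (1 + p) * real (Suc n) powr (- 1 - p))"
        using summable_lerch_bound[OF p(1), of "2 * Gamma (1 + p)"] by (subst (asm) summable_Suc_iff[symmetric])
    qed simp
    show "\<forall>\<^sub>F \<epsilon> in at_right 0. (\<Sum>n. L n \<epsilon>) = (\<Sum>r. T r \<epsilon>) + damped_power p \<epsilon> a / 2 - damped_power_integral p \<epsilon> a"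
      using eventually_at_right_less[of 0]
    proof eventually_elim
      case (elim \<epsilon>)
      have "(\<lambda>n. L n \<epsilon>) sums (lerch_sum p \<epsilon> a - Gamma (1 + p) * \<epsilon> powr (- 1 - p))"
        unfolding L_def using lipschitz_formula[OF p(1) elim, of a] a by simp
      moreover have "(\<lambda>r. T r \<epsilon>) sums (lerch_sum p \<epsilon> a - Gamma (1 + p) * \<epsilon> powr (- 1 - p)
          - damped_power p \<epsilon> a / 2 + damped_power_integral p \<epsilon> a)"
        unfolding T_def by (rule damped_trapezoid_error_sums[OF p(1) elim a])
      ultimately show ?case
        by (simp add: sums_iff)
    qed
  qed
  have lim: "(\<Sum>n. L n 0) = (\<Sum>r. T r 0) + damped_power p 0 a / 2 - damped_power_integral p 0 a"
    by (rule tendsto_unique[OF trivial_limit_at_right_real lim2 lim1])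
  have T: "power_trapezoid_error (- of_real p) (a + real r) = of_real (T r 0)" for r
    unfolding T_def using p a by (intro power_trapezoid_error_of_real) auto
  have "summable (\<lambda>r. power_trapezoid_error (- of_real p) (a + real r))"
    using p a by (intro summable_power_trapezoid_error) (auto simp: complex_eq_iff)
  then have "(\<Sum>r. power_trapezoid_error (- of_real p) (a + real r)) = of_real (\<Sum>r. T r 0)"
    unfolding T by (subst suminf_of_real) (simp_all add: summable_of_real_iff)
  then show ?thesis
    unfolding em_zeta_def L_def[symmetric] lim using p a powr_of_real[of a p] powr_of_real[of a "1 + p"]
    by (simp add: damped_power_integral_0) (simp add: damped_power_def)
qed

section \<open>Analytic continuation and Hurwitz's formula\<close>

text \<open>
  The series in Hurwitz's formula, with \<open>-p\<close> replaced by a complex variable \<open>s\<close>.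
\<close>

definition sine_series :: "complex \<Rightarrow> real \<Rightarrow> complex" where
  "sine_series s a = (\<Sum>n. sin (of_real (2 * pi * a * real (Suc n)) + of_real pi * s / 2)
     * of_real (real (Suc n)) powr (s - 1))"

lemma norm_sin_le_exp_Im: "norm (sin z) \<le> exp \<bar>Im z\<bar>" for z :: complex
proof -
  have "norm (sin z) = norm (exp (\<i> * z) - exp (- (\<i> * z))) / 2"
    by (simp add: sin_exp_eq norm_divide norm_mult)
  also have "\<dots> \<le> (norm (exp (\<i> * z)) + norm (exp (- (\<i> * z)))) / 2"
    by (intro divide_right_mono norm_triangle_ineq4) simp
  also have "\<dots> \<le> (exp \<bar>Im z\<bar> + exp \<bar>Im z\<bar>) / 2"
    by (intro divide_right_mono add_mono) auto
  finally show ?thesis by simp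
qed

lemma summable_sine_series_bound:
  assumes "\<sigma> < 0"
  shows "summable (\<lambda>n. C * real (Suc n) powr (\<sigma> - 1))"
proof -
  have "summable (\<lambda>n. C * real n powr (\<sigma> - 1))"
    using assms by (intro summable_mult) (simp add: summable_real_powr_iff)
  then show ?thesis
    by (subst (asm) summable_Suc_iff[symmetric])
qed

lemma norm_sine_series_term_le:
  assumes "Re s \<le> \<sigma>" "\<bar>Im s\<bar> \<le> M"
  shows "norm (sin (of_real (2 * pi * a * real (Suc n)) + of_real pi * s / 2) * of_real (real (Suc n)) powr (s - 1))
    \<le> exp (pi * M / 2) * real (Suc n) powr (\<sigma> - 1)"
  unfolding norm_mult
proof (intro mult_mono)
  have "pi * \<bar>Im s\<bar> \<le> pi * M"
    using assms by (intro mult_left_mono) auto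
  then have "exp \<bar>Im (of_real (2 * pi * a * real (Suc n)) + of_real pi * s / 2)\<bar> \<le> exp (pi * M / 2)"
    by (simp add: abs_mult)
  then show "norm (sin (of_real (2 * pi * a * real (Suc n)) + of_real pi * s / 2)) \<le> exp (pi * M / 2)"
    using norm_sin_le_exp_Im order_trans by blast
  have "norm (complex_of_real (real (Suc n)) powr (s - 1)) = real (Suc n) powr (Re s - 1)"
    by (subst norm_powr_real_powr) auto
  also have "\<dots> \<le> real (Suc n) powr (\<sigma> - 1)"
    using assms by (intro powr_mono) auto
  finally show "norm (complex_of_real (real (Suc n)) powr (s - 1)) \<le> real (Suc n) powr (\<sigma> - 1)" .
qed auto

lemma sine_series_holomorphic: "(\<lambda>s. sine_series s a) holomorphic_on {s. Re s < 0}"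
  unfolding sine_series_def
proof (rule holomorphic_on_suminf[OF open_halfspace_Re_lt])
  show "(\<lambda>s. sin (of_real (2 * pi * a * real (Suc n)) + of_real pi * s / 2) * of_real (real (Suc n)) powr (s - 1))
      holomorphic_on {s. Re s < 0}" for n
    by (intro holomorphic_intros) (auto simp del: of_nat_Suc)
  fix s0 assume "s0 \<in> {s. Re s < 0}"
  then have s0: "Re s0 < 0"
    by simp
  define d where "d = - Re s0 / 2"
  have "norm (sin (of_real (2 * pi * a * real (Suc n)) + of_real pi * s / 2) * of_real (real (Suc n)) powr (s - 1))
      \<le> exp (pi * (\<bar>Im s0\<bar> + d) / 2) * real (Suc n) powr (Re s0 / 2 - 1)" if "s \<in> ball s0 d" for s n
  proof (rule norm_sine_series_term_le)
    have "\<bar>Re s0 - Re s\<bar> < d" "\<bar>Im s0 - Im s\<bar> < d"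
      using that abs_Re_le_cmod[of "s0 - s"] abs_Im_le_cmod[of "s0 - s"] by (auto simp: dist_norm)
    then show "Re s \<le> Re s0 / 2" "\<bar>Im s\<bar> \<le> \<bar>Im s0\<bar> + d"
      unfolding d_def by linarith+
  qed
  then show "\<exists>d h. 0 < d \<and> summable h \<and> (\<forall>\<^sub>F n in sequentially. \<forall>s\<in>ball s0 d \<inter> {s. Re s < 0}.
      norm (sin (of_real (2 * pi * a * real (Suc n)) + of_real pi * s / 2) * of_real (real (Suc n)) powr (s - 1)) \<le> h n)"
    using s0 summable_sine_series_bound[of "Re s0 / 2" "exp (pi * (\<bar>Im s0\<bar> + d) / 2)"]
    by (intro exI[of _ d] exI[of _ "\<lambda>n. exp (pi * (\<bar>Im s0\<bar> + d) / 2) * real (Suc n) powr (Re s0 / 2 - 1)"] conjI)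
      (auto simp: d_def)
qed

lemma hurwitz_Q_neg:
  "p > 0 \<Longrightarrow> hurwitz_Q (- of_real p) = of_real (2 * Gamma (1 + p) / (2 * pi) powr (1 + p))"
  using powr_of_real[of "2 * pi" "1 + p"] Gamma_complex_of_real[of "1 + p"]
  by (simp add: hurwitz_Q_def)

lemma sine_series_term_neg:
  "sin (of_real (2 * pi * a * real (Suc n)) + of_real pi * (- of_real p) / 2) * of_real (real (Suc n)) powr (- of_real p - 1)
    = complex_of_real (sin (2 * pi * a * real (Suc n) - pi * p / 2) * real (Suc n) powr (- 1 - p))"
proof -
  have "sin (of_real (2 * pi * a * real (Suc n)) + of_real pi * (- of_real p) / 2)
      = complex_of_real (sin (2 * pi * a * real (Suc n) - pi * p / 2))"
    by (simp flip: sin_of_real)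
  moreover have "of_real (real (Suc n)) powr (- of_real p - 1) = complex_of_real (real (Suc n) powr (- 1 - p))"
    using powr_of_real[of "real (Suc n)" "- 1 - p"] by (simp add: minus_diff_commute)
  ultimately show ?thesis
    by (simp only: of_real_mult)
qed

lemma sine_series_neg_sums:
  assumes p: "p > 0"
  shows "(\<lambda>n. complex_of_real (sin (2 * pi * a * real (Suc n) - pi * p / 2) * real (Suc n) powr (- 1 - p)))
     sums sine_series (- of_real p) a"
  unfolding sine_series_def sine_series_term_neg
proof (rule summable_sums, rule summable_comparison_test'[OF summable_sine_series_bound])
  show "- p < 0"
    using p by simp
  show "norm (complex_of_real (sin (2 * pi * a * real (Suc n) - pi * p / 2) * real (Suc n) powr (- 1 - p)))
      \<le> 1 * real (Suc n) powr (- p - 1)" for n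
    unfolding norm_of_real abs_mult by (intro mult_mono) (auto simp: minus_diff_commute)
qed

text \<open>
  The power \<open>(2\<pi>in) powr (- 1 - p)\<close> shifts the phase by \<open>- \<pi>/2 - \<pi>p/2\<close>, and the quarter period in
  this shift turns the cosine in the real part into a sine.
\<close>

lemma lerch_coeff_0_fourier_mode:
  assumes n: "n > 0"
  shows "2 * Re (lerch_coeff p 0 n * fourier_mode (int n) a)
     = 2 * Gamma (1 + p) / (2 * pi) powr (1 + p) * (sin (2 * pi * a * real n - pi * p / 2) * real n powr (- 1 - p))"
proof -
  let ?x = "2 * pi * real n"
  have x: "?x > 0"
    using n by simp
  have "Ln (of_real ?x * \<i>) = of_real (ln ?x) + \<i> * of_real (pi / 2)"
    using x n Ln_of_real[OF x] by (subst Ln_times_of_real) auto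
  then have "(of_real ?x * \<i>) powr of_real (- 1 - p)
      = exp (of_real ((- 1 - p) * ln ?x)) * exp (\<i> * of_real ((- 1 - p) * (pi / 2)))"
    using x n by (simp add: powr_def algebra_simps flip: exp_add)
  also have "\<dots> = of_real (?x powr (- 1 - p)) * cis ((- 1 - p) * (pi / 2))"
    using n by (simp add: powr_def cis_conv_exp flip: exp_of_real)
  finally have "lerch_coeff p 0 n * fourier_mode (int n) a
      = of_real (Gamma (1 + p) * ?x powr (- 1 - p)) * cis ((- 1 - p) * (pi / 2) + 2 * pi * real n * a)"
    by (simp add: lerch_coeff_def fourier_mode_def mult_ac flip: cis_mult)
  moreover have "cos ((- 1 - p) * (pi / 2) + 2 * pi * real n * a) = sin (2 * pi * a * real n - pi * p / 2)"
  proof -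
    have "(- 1 - p) * (pi / 2) + 2 * pi * real n * a = 2 * pi * a * real n - pi * p / 2 - pi / 2"
      by (simp add: field_simps)
    then show ?thesis
      by (simp only: cos_diff[of _ "pi / 2"] cos_pi_half sin_pi_half)
  qed
  moreover have "?x powr (- 1 - p) = real n powr (- 1 - p) / (2 * pi) powr (1 + p)"
  proof -
    have "(2 * pi) powr (- 1 - p) = 1 / (2 * pi) powr (1 + p)"
      using powr_minus_divide[of "2 * pi" "1 + p"] by simp
    then show ?thesis
      by (simp add: powr_mult)
  qed
  ultimately show ?thesis
    by simp
qed

lemma em_zeta_eq_sine_series_neg:
  assumes p: "0 < p" "p < 1" and a: "0 < a" "a \<le> 1"
  shows "em_zeta (- of_real p) a = hurwitz_Q (- of_real p) * sine_series (- of_real p) a"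
proof -
  let ?t = "\<lambda>n. sin (2 * pi * a * real (Suc n) - pi * p / 2) * real (Suc n) powr (- 1 - p)"
  have "em_zeta (- of_real p) a = of_real (\<Sum>n. 2 * Gamma (1 + p) / (2 * pi) powr (1 + p) * ?t n)"
    unfolding em_zeta_neg_eq_fourier_series[OF assms] by (subst lerch_coeff_0_fourier_mode) simp_all
  moreover have "(\<lambda>n. 2 * Gamma (1 + p) / (2 * pi) powr (1 + p) * ?t n) sums
      (2 * Gamma (1 + p) / (2 * pi) powr (1 + p) * Re (sine_series (- of_real p) a))"
    using sums_Re[OF sine_series_neg_sums[OF p(1), of a]] by (intro sums_mult) simp
  moreover have "sine_series (- of_real p) a = of_real (Re (sine_series (- of_real p) a))"
    using sums_Im[OF sine_series_neg_sums[OF p(1), of a]] by (simp add: complex_eq_iff sums_iff)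
  ultimately show ?thesis
    using p by (simp add: hurwitz_Q_neg sums_iff)
qed

lemma hurwitz_Q_holomorphic: "hurwitz_Q holomorphic_on {s. Re s < 0}"
proof -
  have "1 - s \<notin> \<int>\<^sub>\<le>\<^sub>0" if "Re s < 0" for s :: complex
    using that by (auto elim!: nonpos_Ints_cases simp: complex_eq_iff)
  then show ?thesis
    unfolding hurwitz_Q_def[abs_def] by (intro holomorphic_intros) auto
qed

lemma em_zeta_eq_sine_series:
  assumes a: "0 < a" "a \<le> 1" and s: "-1 < Re s" "Re s < 0"
  shows "em_zeta s a = hurwitz_Q s * sine_series s a"
proof -
  let ?S = "{s. Re s > -1} \<inter> {s. Re s < 0}"
  have "em_zeta s a - hurwitz_Q s * sine_series s a = 0"
  proof (rule analytic_continuation[of "\<lambda>s. em_zeta s a - hurwitz_Q s * sine_series s a" ?S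
        "complex_of_real ` {-1<..<0}" "of_real (- 1 / 2)"])
    have "(\<lambda>s. em_zeta s a) holomorphic_on ?S"
      by (rule holomorphic_on_subset[OF em_zeta_holomorphic[OF a(1)]]) auto
    moreover have "(\<lambda>s. hurwitz_Q s * sine_series s a) holomorphic_on ?S"
      by (intro holomorphic_on_mult holomorphic_on_subset[OF hurwitz_Q_holomorphic]
          holomorphic_on_subset[OF sine_series_holomorphic]) auto
    ultimately show "(\<lambda>s. em_zeta s a - hurwitz_Q s * sine_series s a) holomorphic_on ?S"
      by (rule holomorphic_on_diff)
    show "open ?S"
      by (intro open_Int open_halfspace_Re_gt open_halfspace_Re_lt)
    show "connected ?S"
      by (intro convex_connected convex_Int convex_halfspace_Re_gt convex_halfspace_Re_lt)
    have "(- 1 / 2 :: real) islimpt {-1<..<0}"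
      by (intro interior_limit_point) (simp add: interior_open)
    then show "complex_of_real (- 1 / 2) islimpt complex_of_real ` {-1<..<0}"
      by (intro islimpt_isCont_image) (simp_all only: eventually_at_filter of_real_eq_iff, auto)
    show "em_zeta z a - hurwitz_Q z * sine_series z a = 0" if "z \<in> complex_of_real ` {-1<..<0}" for z
    proof -
      from that obtain x where "x \<in> {-1<..<0}" "z = of_real x"
        by blast
      then show ?thesis
        using em_zeta_eq_sine_series_neg[of "- x" a] a by simp
    qed
  qed (use s in auto)
  then show ?thesis by simp
qed

theorem hurwitz_continuation_unit_interval:
  assumes a: "0 < a" "a \<le> 1"
  shows "hurwitz_continuation a (\<lambda>s. if s \<in> {s. Re s < 0} then hurwitz_Q s * sine_series s a else em_zeta s a)"
proof -
  let ?f = "\<lambda>s. if s \<in> {s. Re s < 0} then hurwitz_Q s * sine_series s a else em_zeta s a"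
  have "?f holomorphic_on ({s. Re s < 0} \<union> ({s. Re s > -1} - {1}))"
  proof (rule holomorphic_on_If_Un)
    show "(\<lambda>s. hurwitz_Q s * sine_series s a) holomorphic_on {s. Re s < 0}"
      by (intro holomorphic_on_mult hurwitz_Q_holomorphic sine_series_holomorphic)
    show "(\<lambda>s. em_zeta s a) holomorphic_on ({s. Re s > -1} - {1})"
      by (rule em_zeta_holomorphic[OF a(1)])
  qed (auto intro!: open_halfspace_Re_lt open_halfspace_Re_gt open_Diff simp: em_zeta_eq_sine_series[OF a])
  also have "{s. Re s < 0} \<union> ({s. Re s > -1} - {1}) = - {1}"
    by auto
  finally show ?thesis
    using em_zeta_eq_dirichlet_series[OF _ a(1)] by (simp add: hurwitz_continuation_def)
qed

text \<open>
  Passing from \<open>b\<close> to \<open>b + m\<close> removes the first \<open>m\<close> terms of the Dirichlet series, which are entire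
  functions of \<open>s\<close>.
\<close>

lemma hurwitz_continuation_shift:
  assumes f: "hurwitz_continuation b f" and b: "b > 0"
  shows "hurwitz_continuation (b + real m) (\<lambda>s. f s - (\<Sum>j<m. of_real (b + real j) powr (- s)))"
  unfolding hurwitz_continuation_def
proof (intro conjI allI impI)
  show "(\<lambda>s. f s - (\<Sum>j<m. complex_of_real (b + real j) powr (- s))) holomorphic_on - {1}"
    using f b unfolding hurwitz_continuation_def
    by (intro holomorphic_intros) (auto simp: complex_eq_iff)
  fix s :: complex assume s: "Re s > 1"
  then have "(\<lambda>r. complex_of_real (b + real r) powr (- s)) sums f s"
    using f by (simp add: hurwitz_continuation_def)
  from sums_split_initial_segment[OF this, of m]
  show "(\<lambda>r. complex_of_real (b + real m + real r) powr (- s)) sums (f s - (\<Sum>j<m. of_real (b + real j) powr (- s)))"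
    by (simp add: add_ac)
qed

lemma hurwitz_zeta_shift:
  assumes b: "0 < b" "b \<le> 1" and s: "s \<noteq> 1"
  shows "hurwitz_zeta s (b + real m) = hurwitz_zeta s b - (\<Sum>j<m. of_real (b + real j) powr (- s))"
  using hurwitz_zeta_eqI[OF hurwitz_continuation_shift[OF hurwitz_continuation_unit_interval[OF b] b(1)] s, of m]
    hurwitz_zeta_eqI[OF hurwitz_continuation_unit_interval[OF b] s] by simp

lemma hurwitz_zeta_eq_em_zeta:
  assumes a: "0 < a" "a \<le> 1" and s: "Re s > -1" "s \<noteq> 1"
  shows "hurwitz_zeta s a = em_zeta s a"
  using hurwitz_zeta_eqI[OF hurwitz_continuation_unit_interval[OF a] s(2)] em_zeta_eq_sine_series[OF a, of s] s(1)
  by auto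

text \<open>
  For \<open>s = -p < 0\<close> the continuation is by construction \<open>hurwitz_Q s * sine_series s a\<close>.
\<close>

theorem hurwitz_formula:
  assumes a: "0 < a" "a \<le> 1" and p: "p > 0"
  shows "(\<lambda>n. sin (2 * pi * a * real (Suc n) - pi * p / 2) * real (Suc n) powr (- 1 - p))
      sums Re (hurwitz_zeta (- of_real p) a / hurwitz_Q (- of_real p))"
    and "hurwitz_zeta (- of_real p) a / hurwitz_Q (- of_real p) \<in> \<real>"
proof -
  have "hurwitz_zeta (- of_real p) a = hurwitz_Q (- of_real p) * sine_series (- of_real p) a"
    using p hurwitz_zeta_eqI[OF hurwitz_continuation_unit_interval[OF a], of "- of_real p"]
    by (auto simp: complex_eq_iff)
  moreover have "hurwitz_Q (- of_real p) \<noteq> 0"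
  proof -
    have "Gamma (1 + p) > 0"
      using p by (intro Gamma_real_pos) simp
    then show ?thesis
      unfolding hurwitz_Q_neg[OF p] of_real_eq_0_iff by simp
  qed
  ultimately have eq: "hurwitz_zeta (- of_real p) a / hurwitz_Q (- of_real p) = sine_series (- of_real p) a"
    by simp
  show "(\<lambda>n. sin (2 * pi * a * real (Suc n) - pi * p / 2) * real (Suc n) powr (- 1 - p))
      sums Re (hurwitz_zeta (- of_real p) a / hurwitz_Q (- of_real p))"
    unfolding eq using sums_Re[OF sine_series_neg_sums[OF p, of a]] by simp
  show "hurwitz_zeta (- of_real p) a / hurwitz_Q (- of_real p) \<in> \<real>"
    unfolding eq complex_is_Real_iff using sums_Im[OF sine_series_neg_sums[OF p, of a]] by (simp add: sums_iff)
qed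

section \<open>Lower bounds for the Gamma function\<close>

lemma ln_1_plus_ge:
  assumes "y \<ge> (0::real)"
  shows "y - y\<^sup>2 / 2 \<le> ln (1 + y)"
proof -
  have "ln (1 + 0) - 0 + 0\<^sup>2 / 2 \<le> ln (1 + y) - y + y\<^sup>2 / 2"
  proof (rule DERIV_nonneg_imp_nondecreasing[OF assms])
    fix x :: real assume x: "0 \<le> x" "x \<le> y"
    have "((\<lambda>y. ln (1 + y) - y + y\<^sup>2 / 2) has_real_derivative x\<^sup>2 / (1 + x)) (at x)"
      using x by (auto intro!: derivative_eq_intros simp: field_simps power2_eq_square)
    then show "\<exists>D. ((\<lambda>y. ln (1 + y) - y + y\<^sup>2 / 2) has_real_derivative D) (at x) \<and> 0 \<le> D"
      using x by (intro exI[of _ "x\<^sup>2 / (1 + x)"] conjI) auto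
  qed
  then show ?thesis by simp
qed

text \<open>
  On the interval \<open>[p, p + sqrt p]\<close> the integrand of Euler's integral stays within the factor
  \<open>exp (-1/2)\<close> of its maximal value \<open>p powr p * exp (-p)\<close>. This gives Stirling's order of
  magnitude with a smaller constant.
\<close>

lemma Gamma_ge_stirling:
  assumes p: "p > (0::real)"
  shows "Gamma (1 + p) \<ge> exp (- 1 / 2) * (sqrt p * (p powr p * exp (- p)))"
proof -
  let ?c = "exp (- 1 / 2) * (p powr p * exp (- p))"
  let ?f = "\<lambda>x. x powr p * exp (- x)"
  have f: "(?f has_integral Gamma (1 + p)) {0..}"
    using Gamma_integral_real[of "1 + p"] p by (simp add: exp_minus divide_inverse)
  have lower: "?c \<le> ?f x" if x: "x \<in> {p..p + sqrt p}" for x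
  proof -
    define y where "y = (x - p) / p"
    have y: "y \<ge> 0" "x = p * (1 + y)"
      using x p by (auto simp: y_def field_simps)
    have "p * y \<le> sqrt p"
      using x p by (simp add: y_def)
    then have "(p * y)\<^sup>2 \<le> p"
      using p y power_mono[of "p * y" "sqrt p" 2] by simp
    moreover have "(p * y)\<^sup>2 = p * (p * y\<^sup>2)"
      by (simp add: power2_eq_square)
    ultimately have "p * (p * y\<^sup>2) \<le> p * 1"
      by (simp only: mult_1_right)
    then have "p * y\<^sup>2 \<le> 1"
      using p by (rule mult_left_le_imp_le)
    moreover have "p * (y - y\<^sup>2 / 2) \<le> p * ln (1 + y)"
      using ln_1_plus_ge[OF y(1)] p by (intro mult_left_mono) auto
    moreover have "p * (y - y\<^sup>2 / 2) = p * y - p * y\<^sup>2 / 2" "x = p + p * y"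
      using y by (simp_all add: algebra_simps)
    moreover have "p * ln x = p * ln p + p * ln (1 + y)"
    proof -
      have "ln (p * (1 + y)) = ln p + ln (1 + y)"
        using p y(1) by (subst ln_mult) auto
      then show ?thesis
        by (simp only: y(2) distrib_left[of p "ln p"])
    qed
    ultimately have "- 1 / 2 + (p * ln p - p) \<le> p * ln x - x"
      by linarith
    then have "exp (- 1 / 2 + (p * ln p - p)) \<le> exp (p * ln x - x)"
      by simp
    then show ?thesis
      using p x by (simp add: powr_def exp_diff exp_minus exp_add field_simps flip: exp_add)
  qed
  have "continuous_on {p..p + sqrt p} ?f"
    using p by (intro continuous_on_mult continuous_on_powr' continuous_intros) auto
  then have int: "?f integrable_on {p..p + sqrt p}"
    by (rule integrable_continuous_real)
  have "sqrt p * ?c = integral {p..p + sqrt p} (\<lambda>_. ?c)"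
    using p by simp
  also have "\<dots> \<le> integral {p..p + sqrt p} ?f"
    by (intro integral_le lower int integrable_const_ivl)
  also have "\<dots> \<le> Gamma (1 + p)"
    using p by (intro has_integral_subset_le[OF _ integrable_integral[OF int] f]) auto
  finally show ?thesis
    by (simp add: mult_ac)
qed

text \<open>
  The lower bound of Stirling type degenerates at \<open>p = 0\<close>, so it is used at \<open>1 + p\<close> and carried back by
  the functional equation.
\<close>

lemma Gamma_ge_const:
  assumes p: "p > (0::real)" "p \<le> 1"
  shows "Gamma (1 + p) \<ge> exp (- 5 / 2) / 2"
proof -
  let ?q = "1 + p"
  have "exp (- 1 / 2) * (1 * (1 * exp (- 2))) \<le> exp (- 1 / 2) * (sqrt ?q * (?q powr ?q * exp (- ?q)))"
    using p by (intro mult_mono mult_left_mono) (auto intro!: ge_one_powr_ge_zero)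
  also have "\<dots> \<le> Gamma (1 + ?q)"
    using p by (intro Gamma_ge_stirling) simp
  also have "\<dots> = ?q * Gamma ?q"
    using p Gamma_plus1[of ?q] nonpos_Ints_nonpos[of ?q] by (subst add.commute) auto
  also have "\<dots> \<le> 2 * Gamma ?q"
    using p Gamma_real_pos[of ?q] by (intro mult_right_mono) auto
  finally show ?thesis
    by (simp flip: exp_add)
qed

section \<open>The error for a in the unit interval\<close>

definition hurwitz_error :: "real \<Rightarrow> real \<Rightarrow> real" where
  "hurwitz_error p a =
    cmod (hurwitz_zeta (complex_of_real (- p)) a / hurwitz_Q (complex_of_real (- p))
      - complex_of_real (sin (2 * pi * a - pi * p / 2)))"

text \<open>
  For \<open>n \<ge> 2\<close> the exponent is split as \<open>1 + p = 3/2 + (p - 1/2)\<close>: the first part keeps the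
  series convergent, uniformly in \<open>p\<close>, and the second part contributes at most
  \<open>2 powr (1/2 - p)\<close>, its value at \<open>n = 2\<close>.
\<close>

lemma hurwitz_error_le_large:
  assumes a: "0 < a" "a \<le> 1" and p: "p \<ge> 1 / 2"
  shows "hurwitz_error p a \<le> 2 * (\<Sum>n. real (Suc n) powr (- 3 / 2)) * 2 powr (- p)"
proof -
  let ?t = "\<lambda>n. sin (2 * pi * a * real (Suc n) - pi * p / 2) * real (Suc n) powr (- 1 - p)"
  let ?z = "hurwitz_zeta (- of_real p) a / hurwitz_Q (- of_real p)"
  have p0: "p > 0"
    using p by simp
  have "(\<lambda>n. ?t (Suc n)) sums (Re ?z - ?t 0)"
    using hurwitz_formula(1)[OF a p0] by (subst sums_Suc_iff) simp
  then have tail: "Re ?z - sin (2 * pi * a - pi * p / 2) = (\<Sum>n. ?t (Suc n))"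
    by (simp add: sums_iff)
  have summ: "summable (\<lambda>n. real (Suc n) powr (- 3 / 2))"
    using summable_sine_series_bound[of "- 1 / 2" 1] by simp
  have bound: "norm (?t (Suc n)) \<le> 2 * 2 powr (- p) * real (Suc (Suc n)) powr (- 3 / 2)" for n
  proof -
    let ?N = "real (Suc (Suc n))"
    have "?N powr (- 1 - p) = ?N powr (1 / 2 - p) * ?N powr (- 3 / 2)"
      by (simp flip: powr_add)
    also have "?N powr (1 / 2 - p) \<le> 2 powr (1 / 2 - p)"
      using p by (intro powr_mono2') auto
    also have "2 powr (1 / 2 - p) = 2 powr (1 / 2) * 2 powr (- p :: real)"
      by (simp flip: powr_add)
    also have "2 powr (1 / 2) \<le> 2 powr (1 :: real)"
      by (intro powr_mono) auto
    finally have "?N powr (- 1 - p) \<le> 2 * 2 powr (- p) * ?N powr (- 3 / 2)"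
      by (simp add: mult_right_mono)
    moreover have "norm (?t (Suc n)) \<le> 1 * ?N powr (- 1 - p)"
      unfolding real_norm_def abs_mult by (intro mult_mono) auto
    ultimately show ?thesis
      by linarith
  qed
  have summ1: "summable (\<lambda>n. real (Suc (Suc n)) powr (- 3 / 2))"
    using summ by (subst (asm) summable_Suc_iff[symmetric])
  note summ2 = summable_mult[OF summ1, of "2 * 2 powr (- p)"]
  have "hurwitz_error p a = \<bar>Re ?z - sin (2 * pi * a - pi * p / 2)\<bar>"
  proof -
    have "?z = of_real (Re ?z)"
      using hurwitz_formula(2)[OF a p0] by simp
    then have "?z - of_real (sin (2 * pi * a - pi * p / 2)) = of_real (Re ?z - sin (2 * pi * a - pi * p / 2))"
      by (metis of_real_diff)
    then show ?thesis
      by (simp only: hurwitz_error_def of_real_minus norm_of_real)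
  qed
  also have "\<dots> = norm (\<Sum>n. ?t (Suc n))"
    unfolding tail by simp
  also have "\<dots> \<le> (\<Sum>n. 2 * 2 powr (- p) * real (Suc (Suc n)) powr (- 3 / 2))"
    by (rule norm_suminf_le[OF bound summ2])
  also have "\<dots> = 2 * 2 powr (- p) * (\<Sum>n. real (Suc (Suc n)) powr (- 3 / 2))"
    by (rule suminf_mult[OF summ1])
  also have "(\<Sum>n. real (Suc (Suc n)) powr (- 3 / 2)) \<le> (\<Sum>n. real (Suc n) powr (- 3 / 2))"
    using suminf_split_head[OF summ] by simp
  finally show ?thesis
    by (simp add: mult_ac)
qed

text \<open>
  The bound does not depend on \<open>p\<close> or \<open>a\<close>. The trapezoid error on \<open>[a, a + 1]\<close> is bounded through
  its definition, because the second derivative of \<open>x powr p\<close> is unbounded near \<open>0\<close>; the other errors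
  are at most \<open>r powr (p - 2)\<close>.
\<close>

lemma norm_hurwitz_zeta_le_small:
  assumes a: "0 < a" "a \<le> 1" and p: "0 < p" "p \<le> 1 / 2"
  shows "norm (hurwitz_zeta (- of_real p) a) \<le> 8 + (\<Sum>n. real (Suc n) powr (- 3 / 2))"
proof -
  let ?T = "\<lambda>r. power_trapezoid_error (- of_real p) (a + real r)"
  have re: "Re (- of_real p) > -1" "- complex_of_real p \<noteq> 1"
    using p by (auto simp: complex_eq_iff)
  have summ: "summable (\<lambda>n. real (Suc n) powr (- 3 / 2))"
    using summable_sine_series_bound[of "- 1 / 2" 1] by simp
  have pow: "norm (complex_of_real x powr of_real q) \<le> 4" if "0 \<le> x" "x \<le> 2" "0 \<le> q" "q \<le> 2" for x q
  proof -
    have "norm (complex_of_real x powr of_real q) = x powr q"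
      using that by (simp add: norm_powr_real_powr)
    also have "\<dots> \<le> 2 powr q"
      using that by (intro powr_mono2) auto
    also have "\<dots> \<le> 2 powr 2"
      using that by (intro powr_mono) auto
    finally show ?thesis by simp
  qed
  have pow1: "norm (complex_of_real x powr of_real q) \<le> 1" if "0 \<le> x" "x \<le> 1" "0 \<le> q" for x q
    using that by (simp add: norm_powr_real_powr powr_le1)
  have div: "norm (z / complex_of_real (1 + p)) \<le> norm z" for z
  proof -
    have "norm (complex_of_real (1 + p)) = 1 + p"
      using p by (simp only: norm_of_real)
    moreover have "norm z * 1 \<le> norm z * (1 + p)"
      using p by (intro mult_left_mono) auto
    ultimately show ?thesis
      using p by (simp only: norm_divide) (simp add: divide_le_eq)
  qed
  define A where "A x = complex_of_real x powr of_real p" for x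
  define B where "B x = complex_of_real x powr of_real (1 + p) / complex_of_real (1 + p)" for x
  have T0: "?T 0 = (A a + A (a + 1)) / 2 - (B (a + 1) - B a)"
    by (simp add: power_trapezoid_error_def trapezoid_error_def A_def B_def scaleR_conv_of_real)
  have tail: "norm (?T (Suc n)) \<le> real (Suc n) powr (- 3 / 2)" for n
  proof -
    have "norm (?T (Suc n)) \<le> norm (- of_real p * (- complex_of_real p + 1)) * real (Suc n) powr (- Re (- of_real p) - 2)"
      using re a by (intro norm_power_trapezoid_error_shift_le) auto
    also have "norm (- of_real p * (- complex_of_real p + 1)) = p * (1 - p)"
    proof -
      have "- of_real p * (- complex_of_real p + 1) = of_real (- (p * (1 - p)))"
        by (simp add: algebra_simps)
      then show ?thesis
        using p by (simp only: norm_of_real) simp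
    qed
    also have "p * (1 - p) \<le> 1"
      using p by (intro mult_le_one) auto
    also have "real (Suc n) powr (- Re (- of_real p) - 2) \<le> real (Suc n) powr (- 3 / 2)"
      using p by (intro powr_mono) auto
    finally show ?thesis
      by (simp add: mult_right_mono)
  qed
  have "hurwitz_zeta (- of_real p) a = A a / 2 - B a + (\<Sum>r. ?T r)"
    using hurwitz_zeta_eq_em_zeta[OF a re] by (simp add: em_zeta_def A_def B_def)
  also have "(\<Sum>r. ?T r) = ?T 0 + (\<Sum>r. ?T (Suc r))"
    using suminf_split_head[OF summable_power_trapezoid_error[OF re a(1)]] by simp
  also have "A a / 2 - B a + (?T 0 + (\<Sum>r. ?T (Suc r))) = A a + A (a + 1) / 2 - B (a + 1) + (\<Sum>r. ?T (Suc r))"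
    unfolding T0 by (simp add: field_simps)
  finally have eq: "hurwitz_zeta (- of_real p) a = A a + A (a + 1) / 2 - B (a + 1) + (\<Sum>r. ?T (Suc r))" .
  have "norm (A a) \<le> 1"
    unfolding A_def using a p by (intro pow1) auto
  moreover have "norm (A (a + 1) / 2) \<le> 2"
    using pow[of "a + 1" p] a p by (simp add: A_def norm_divide)
  moreover have "norm (B (a + 1)) \<le> 4"
    unfolding B_def using a p by (intro order_trans[OF div] pow) auto
  moreover have "norm (\<Sum>r. ?T (Suc r)) \<le> (\<Sum>n. real (Suc n) powr (- 3 / 2))"
    by (rule norm_suminf_le[OF tail summ])
  ultimately show ?thesis
    unfolding eq
    using norm_triangle_ineq[of "A a + A (a + 1) / 2 - B (a + 1)" "\<Sum>r. ?T (Suc r)"]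
      norm_triangle_ineq4[of "A a + A (a + 1) / 2" "B (a + 1)"] norm_triangle_ineq[of "A a" "A (a + 1) / 2"]
    by linarith
qed

lemma inverse_hurwitz_Q_le_small:
  assumes p: "0 < p" "p \<le> 1"
  shows "1 / norm (hurwitz_Q (- of_real p)) \<le> (2 * pi)\<^sup>2 * exp (5 / 2)"
proof -
  have G: "Gamma (1 + p) \<ge> exp (- 5 / 2) / 2"
    by (rule Gamma_ge_const[OF p])
  then have G0: "Gamma (1 + p) > 0"
    using exp_gt_zero[of "- 5 / 2 :: real"] by linarith
  have "1 / norm (hurwitz_Q (- of_real p)) = (2 * pi) powr (1 + p) / (2 * Gamma (1 + p))"
    unfolding hurwitz_Q_neg[OF p(1)] norm_of_real using G0 by (simp add: abs_mult)
  also have "\<dots> \<le> (2 * pi) powr 2 / exp (- 5 / 2)"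
    using p G G0 pi_gt3 by (intro frac_le powr_mono) auto
  also have "exp (- 5 / 2 :: real) = inverse (exp (5 / 2))"
    using exp_minus[of "5 / 2 :: real"] by simp
  finally show ?thesis
    by (simp add: divide_inverse[of _ "inverse _"])
qed

text \<open>
  For \<open>p \<ge> 1/2\<close> the tail of Hurwitz's series is small. For \<open>p < 1/2\<close> the error is merely bounded,
  which is enough because \<open>2 powr (- p)\<close> is then bounded below.
\<close>

lemma hurwitz_error_unit_interval:
  "\<exists>C>0. \<forall>p a. 0 < p \<longrightarrow> 0 < a \<longrightarrow> a \<le> 1 \<longrightarrow> hurwitz_error p a \<le> C * 2 powr (- p)"
proof -
  define Z where "Z = (\<Sum>n. real (Suc n) powr (- 3 / 2))"
  have Z: "Z \<ge> 0"
    using summable_sine_series_bound[of "- 1 / 2" 1] unfolding Z_def by (intro suminf_nonneg) auto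
  define K where "K = (8 + Z) * ((2 * pi)\<^sup>2 * exp (5 / 2)) + 1"
  have K: "K \<ge> 1"
    using Z by (simp add: K_def)
  have "hurwitz_error p a \<le> (2 * Z + 2 * K) * 2 powr (- p)" if p: "0 < p" and a: "0 < a" "a \<le> 1" for p a
  proof (cases "p \<ge> 1 / 2")
    case True
    have "hurwitz_error p a \<le> 2 * Z * 2 powr (- p)"
      unfolding Z_def by (rule hurwitz_error_le_large[OF a True])
    also have "\<dots> \<le> (2 * Z + 2 * K) * 2 powr (- p)"
      using K by (intro mult_right_mono) auto
    finally show ?thesis .
  next
    case False
    have "hurwitz_error p a \<le> norm (hurwitz_zeta (- of_real p) a) * (1 / norm (hurwitz_Q (- of_real p)))
        + norm (complex_of_real (sin (2 * pi * a - pi * p / 2)))"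
      unfolding hurwitz_error_def of_real_minus
      by (rule order_trans[OF norm_triangle_ineq4]) (simp add: norm_divide)
    also have "\<dots> \<le> (8 + Z) * ((2 * pi)\<^sup>2 * exp (5 / 2)) + 1"
      unfolding Z_def using False p a Z[unfolded Z_def]
      by (intro add_mono mult_mono norm_hurwitz_zeta_le_small inverse_hurwitz_Q_le_small) auto
    also have "\<dots> = 2 * K * (1 / 2)"
      by (simp add: K_def)
    also have "\<dots> \<le> (2 * Z + 2 * K) * 2 powr (- p)"
    proof (intro mult_mono)
      \<comment> \<open>A nonnegative constant is at most twice its product with \<open>2 powr (- p)\<close> because \<open>p \<le> 1\<close>.\<close>
      have "(2 :: real) powr (- 1) \<le> 2 powr (- p)"
        using False by (intro powr_mono) auto
      then show "1 / 2 \<le> (2 :: real) powr (- p)"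
        by (simp add: powr_minus_divide)
    qed (use K Z in auto)
    finally show ?thesis .
  qed
  then show ?thesis
    using K Z by (intro exI[of _ "2 * Z + 2 * K"]) auto
qed

section \<open>The error for general a\<close>

text \<open>
  With \<open>a = b + m\<close>, the \<open>k\<close>-th term from the top is \<open>a powr p * (1 - (k + 1) / a) powr p\<close>. Here
  \<open>1 - x \<le> exp (-x)\<close> bounds the second factor by \<open>exp (- (k + 1) * p / a)\<close>, and \<open>p / a \<ge> 1 / \<alpha>\<close>.
\<close>

lemma sum_shifted_powers_le:
  assumes b: "b > 0" and p: "p > 0" and \<alpha>: "\<alpha> > 0" and le: "b + real m \<le> \<alpha> * p"
  shows "(\<Sum>j<m. (b + real j) powr p) \<le> (\<alpha> * p) powr p / (1 - exp (- 1 / \<alpha>))"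
proof -
  define a where "a = b + real m"
  have a: "a > 0" "a \<le> \<alpha> * p"
    using b le by (auto simp: a_def)
  define q where "q = exp (- 1 / \<alpha>)"
  have q: "0 < q" "q < 1"
    using \<alpha> by (auto simp: q_def)
  have geom: "(b + real (m - Suc k)) powr p \<le> a powr p * q ^ k" if k: "k < m" for k
  proof -
    let ?x = "(real k + 1) / a"
    have eq: "b + real (m - Suc k) = a * (1 - ?x)"
      using k a by (simp add: a_def of_nat_diff field_simps)
    then have x: "1 - ?x > 0"
      using b a by (metis add_pos_nonneg of_nat_0_le_iff zero_less_mult_pos)
    have "1 - ?x \<le> exp (- ?x)"
      using exp_ge_add_one_self[of "- ?x"] by simp
    then have "(1 - ?x) powr p \<le> exp (- ?x) powr p"
      using x p by (intro powr_mono2) auto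
    also have "\<dots> = exp (- (p / a * (real k + 1)))"
      by (simp add: powr_def)
    also have "\<dots> \<le> exp (- (1 / \<alpha> * real k))"
    proof -
      have "1 / \<alpha> \<le> p / a"
        using a \<alpha> by (simp add: field_simps)
      then have "1 / \<alpha> * real k \<le> p / a * (real k + 1)"
        using \<alpha> p a by (intro mult_mono) auto
      then show ?thesis by simp
    qed
    also have "\<dots> = q ^ k"
      by (simp add: q_def mult.commute flip: exp_of_nat_mult)
    finally have "(1 - ?x) powr p \<le> q ^ k" .
    then show ?thesis
      unfolding eq using a x by (simp add: powr_mult mult_left_mono)
  qed
  have "(\<Sum>j<m. (b + real j) powr p) = (\<Sum>k<m. (b + real (m - Suc k)) powr p)"
    by (rule sum.nat_diff_reindex[symmetric])
  also have "\<dots> \<le> (\<Sum>k<m. a powr p * q ^ k)"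
    using geom by (intro sum_mono) auto
  also have "\<dots> = a powr p * (\<Sum>k<m. q ^ k)"
    by (simp add: sum_distrib_left)
  also have "(\<Sum>k<m. q ^ k) \<le> (\<Sum>k. q ^ k)"
    using q by (intro sum_le_suminf) (auto intro: summable_geometric)
  also have "(\<Sum>k. q ^ k) = 1 / (1 - q)"
    using q by (intro suminf_geometric) auto
  also have "a powr p \<le> (\<alpha> * p) powr p"
    using a p by (intro powr_mono2) auto
  finally show ?thesis
    using q by (simp add: q_def divide_right_mono mult_left_mono)
qed

lemma inverse_hurwitz_Q_le:
  assumes p: "p > 0"
  shows "1 / norm (hurwitz_Q (- of_real p)) \<le> pi * exp (1 / 2) * p powr (- 1 / 2) * (2 * pi * exp 1 / p) powr p"
proof -
  let ?S = "exp (- 1 / 2) * (sqrt p * (p powr p * exp (- p)))"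
  have S0: "?S > 0"
    using p by simp
  have S: "?S \<le> Gamma (1 + p)"
    by (rule Gamma_ge_stirling[OF p])
  have "1 / norm (hurwitz_Q (- of_real p)) = (2 * pi) powr (1 + p) / (2 * Gamma (1 + p))"
    unfolding hurwitz_Q_neg[OF p] norm_of_real using S S0 by (simp add: abs_mult)
  also have "\<dots> \<le> (2 * pi) powr (1 + p) / (2 * ?S)"
    using S S0 by (intro divide_left_mono) auto
  also have "\<dots> = pi * exp (1 / 2) * p powr (- 1 / 2) * (2 * pi * exp 1 / p) powr p"
  proof -
    have 1: "(2 * pi) powr (1 + p) = 2 * pi * (2 * pi) powr p"
      by (simp add: powr_add)
    have 2: "(2 * pi * exp 1 / p) powr p = (2 * pi) powr p * exp p / p powr p"
      using p by (simp add: powr_divide powr_mult exp_powr_real)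
    have 3: "p powr (- 1 / 2) = 1 / sqrt p"
      using p by (simp add: powr_minus_divide powr_half_sqrt)
    have 4: "exp (- 1 / 2) = 1 / exp (1 / 2 :: real)" "exp (- p) = 1 / exp p"
      using exp_minus[of "1 / 2 :: real"] exp_minus[of p] by (simp_all add: inverse_eq_divide)
    show ?thesis
      unfolding 1 2 3 4 by (simp add: divide_simps)
  qed
  finally show ?thesis .
qed

text \<open>
  The integer shift \<open>m\<close> is chosen with \<open>0 < a - m \<le> 1\<close>. Its contribution gives the first term of the
  bound and the error at \<open>a - m\<close> the second one; \<open>C + 1\<close> in place of \<open>C\<close> makes the inequality strict.
\<close>

lemma hurwitz_error_bound:
  assumes \<alpha>: "\<alpha> > 0"
  shows "\<exists>C1 C2. \<forall>p a. p \<ge> 0 \<longrightarrow> 0 < a \<longrightarrow> a < \<alpha> * p \<longrightarrow>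
    hurwitz_error p a < C1 * p powr (- 1 / 2) * (2 * pi * exp 1 * \<alpha>) powr p + C2 * 2 powr (- p)"
proof -
  obtain C where C: "C > 0" "\<And>p a. 0 < p \<Longrightarrow> 0 < a \<Longrightarrow> a \<le> 1 \<Longrightarrow> hurwitz_error p a \<le> C * 2 powr (- p)"
    using hurwitz_error_unit_interval by blast
  define D where "D = 1 - exp (- 1 / \<alpha>)"
  have D: "D > 0"
    using \<alpha> by (simp add: D_def)
  define C1 where "C1 = pi * exp (1 / 2) / D"
  have "hurwitz_error p a < C1 * p powr (- 1 / 2) * (2 * pi * exp 1 * \<alpha>) powr p + (C + 1) * 2 powr (- p)"
    if "p \<ge> 0" and a: "0 < a" "a < \<alpha> * p" for p a
  proof -
    have p: "p > 0"
      using that by (cases "p = 0") auto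
    define m where "m = nat (\<lceil>a\<rceil> - 1)"
    define b where "b = a - real m"
    have "\<lceil>a\<rceil> \<ge> 1"
      using a by linarith
    then have "real m = of_int \<lceil>a\<rceil> - 1"
      by (simp add: m_def)
    then have b: "0 < b" "b \<le> 1" and ab: "a = b + real m"
      unfolding b_def by linarith+
    let ?s = "- complex_of_real p" and ?S = "\<Sum>j<m. (b + real j) powr p"
    have "hurwitz_zeta ?s a = hurwitz_zeta ?s b - (\<Sum>j<m. of_real (b + real j) powr (- ?s))"
      unfolding ab using p by (intro hurwitz_zeta_shift b) (auto simp: complex_eq_iff)
    also have "(\<Sum>j<m. of_real (b + real j) powr (- ?s)) = of_real ?S"
    proof -
      have "of_real (b + real j) powr (- ?s) = complex_of_real ((b + real j) powr p)" for j
        unfolding minus_minus using b by (intro powr_of_real) simp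
      then show ?thesis
        by (simp only: of_real_sum)
    qed
    finally have shift: "hurwitz_zeta ?s a = hurwitz_zeta ?s b - of_real ?S" .
    have sin: "sin (2 * pi * a - pi * p / 2) = sin (2 * pi * b - pi * p / 2)"
    proof -
      have "2 * pi * a - pi * p / 2 = 2 * pi * b - pi * p / 2 + 2 * real m * pi"
        by (simp add: ab algebra_simps)
      then show ?thesis
        by (simp only: sin_add[of _ "2 * real m * pi"] sin_2npi cos_2npi mult_1_right mult_zero_right add_0_right)
    qed
    have S0: "?S \<ge> 0"
      by (intro sum_nonneg) simp
    have "hurwitz_error p a = norm (hurwitz_zeta ?s b / hurwitz_Q ?s - of_real (sin (2 * pi * b - pi * p / 2))
        - of_real ?S / hurwitz_Q ?s)"
      unfolding hurwitz_error_def of_real_minus shift sin by (simp add: diff_divide_distrib algebra_simps)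
    also have "\<dots> \<le> hurwitz_error p b + ?S * (1 / norm (hurwitz_Q ?s))"
      unfolding hurwitz_error_def of_real_minus using S0
      by (intro order_trans[OF norm_triangle_ineq4]) (simp add: norm_divide del: of_real_sum)
    also have "?S * (1 / norm (hurwitz_Q ?s))
        \<le> ((\<alpha> * p) powr p / D) * (pi * exp (1 / 2) * p powr (- 1 / 2) * (2 * pi * exp 1 / p) powr p)"
      unfolding D_def using S0 a p \<alpha> b ab D
      by (intro mult_mono sum_shifted_powers_le inverse_hurwitz_Q_le) (auto simp: D_def)
    also have "\<dots> = C1 * p powr (- 1 / 2) * ((\<alpha> * p) powr p * (2 * pi * exp 1 / p) powr p)"
      by (simp add: C1_def)
    also have "(\<alpha> * p) powr p * (2 * pi * exp 1 / p) powr p = (2 * pi * exp 1 * \<alpha>) powr p"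
      using p \<alpha> by (subst powr_mult[symmetric]) (auto simp: mult_ac)
    also have "hurwitz_error p b \<le> C * 2 powr (- p)"
      by (rule C(2)[OF p b])
    also have "C * 2 powr (- p) < (C + 1) * 2 powr (- p)"
      by simp
    finally show ?thesis
      by simp
  qed
  then show ?thesis
    by blast
qed

lemma hurwitz_error_uniform_limit:
  "((\<lambda>p. SUP a \<in> {0 <..< p / (2 * pi * exp 1)}. ereal (hurwitz_error p a)) \<longlongrightarrow> 0) at_top"
proof -
  define \<alpha> :: real where "\<alpha> = 1 / (2 * pi * exp 1)"
  have \<alpha>: "\<alpha> > 0" "2 * pi * exp 1 * \<alpha> = 1"
    by (auto simp: \<alpha>_def)
  obtain C1 C2 where C: "\<And>p a. p \<ge> 0 \<Longrightarrow> 0 < a \<Longrightarrow> a < \<alpha> * p \<Longrightarrow>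
      hurwitz_error p a < C1 * p powr (- 1 / 2) * (2 * pi * exp 1 * \<alpha>) powr p + C2 * 2 powr (- p)"
    using hurwitz_error_bound[OF \<alpha>(1)] by blast
  let ?B = "\<lambda>p. C1 * p powr (- 1 / 2) + C2 * 2 powr (- p)"
  have "(?B \<longlongrightarrow> 0) at_top"
    by real_asymp
  then have B: "((\<lambda>p. ereal (?B p)) \<longlongrightarrow> 0) at_top"
    by (simp add: zero_ereal_def)
  show ?thesis
  proof (rule tendsto_sandwich[OF _ _ tendsto_const B])
    \<comment> \<open>For \<open>p \<le> 0\<close> the interval is empty and the supremum is \<open>- \<infinity>\<close>.\<close>
    show "\<forall>\<^sub>F p in at_top. 0 \<le> (SUP a \<in> {0 <..< p / (2 * pi * exp 1)}. ereal (hurwitz_error p a))"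
      using eventually_gt_at_top[of 0]
    proof eventually_elim
      case (elim p)
      have "p / (2 * pi * exp 1) / 2 \<in> {0 <..< p / (2 * pi * exp 1)}"
        using elim by (simp add: field_simps)
      then show ?case
        by (rule SUP_upper2) (simp add: hurwitz_error_def)
    qed
    show "\<forall>\<^sub>F p in at_top. (SUP a \<in> {0 <..< p / (2 * pi * exp 1)}. ereal (hurwitz_error p a)) \<le> ereal (?B p)"
      using eventually_gt_at_top[of 0]
    proof eventually_elim
      case (elim p)
      show ?case
      proof (rule SUP_least)
        fix a assume "a \<in> {0 <..< p / (2 * pi * exp 1)}"
        then have "hurwitz_error p a < C1 * p powr (- 1 / 2) * (2 * pi * exp 1 * \<alpha>) powr p + C2 * 2 powr (- p)"
          using elim by (intro C) (auto simp: \<alpha>_def)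
        then show "ereal (hurwitz_error p a) \<le> ereal (?B p)"
          by (simp add: \<alpha>(2))
      qed
    qed
  qed
qed

theorem theorem1:
  fixes \<alpha> :: real
  assumes "\<alpha> > 0"
  shows "(\<exists>C1 C2 :: real. \<forall>p a :: real. p \<ge> 0 \<longrightarrow> 0 < a \<longrightarrow> a < \<alpha> * p \<longrightarrow>
            cmod (hurwitz_zeta (complex_of_real (- p)) a / hurwitz_Q (complex_of_real (- p))
                  - complex_of_real (sin (2 * pi * a - pi * p / 2)))
              < C1 * p powr (- 1 / 2) * (2 * pi * exp 1 * \<alpha>) powr p + C2 * 2 powr (- p))
       \<and> ((\<lambda>p :: real. SUP a \<in> {0 <..< p / (2 * pi * exp 1)}.
            ereal (cmod (hurwitz_zeta (complex_of_real (- p)) a / hurwitz_Q (complex_of_real (- p))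
                         - complex_of_real (sin (2 * pi * a - pi * p / 2))))) \<longlongrightarrow> 0) at_top"
  using hurwitz_error_bound[OF assms] hurwitz_error_uniform_limit
  unfolding hurwitz_error_def by (rule conjI)

end
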